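(* Let $K=\mathbb{Q}(\sqrt{p},\sqrt{q})$ be a real biquadratic field (with $p,q>1$ distinct square-free integers) such that $K$ does not contain any of $\sqrt{2}$, $\sqrt{3}$, $\sqrt{5}$, $\sqrt{6}$, $\sqrt{7}$, $\sqrt{13}$. Then $\mathcal{P}(\mathcal{O}_K)\geq 6$.
   Context: $\mathcal{O}_K$ denotes the ring of algebraic integers of $K$. For a commutative ring $\mathcal{O}$, let $\sum\mathcal{O}^2$ be the set of elements of $\mathcal{O}$ that are sums of squares of elements of $\mathcal{O}$, and $\sum^m\mathcal{O}^2$ the set of those that are sums of at most $m$ squares. The Pythagoras number is $\mathcal{P}(\mathcal{O})=\inf\{m\in\mathbb{N}\cup\{+\infty\} : \sum\mathcal{O}^2=\sum^m\mathcal{O}^2\}$. *)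

theory Defs
  imports
    Complex_Main
    "HOL-Library.Extended_Nat"
    "HOL-Computational_Algebra.Computational_Algebra"
begin

definition is_subfield :: "'a::field set \<Rightarrow> bool" where
  "is_subfield F \<longleftrightarrow>
     0 \<in> F \<and> 1 \<in> F \<and>
     (\<forall>x\<in>F. - x \<in> F) \<and> (\<forall>x\<in>F. inverse x \<in> F) \<and>
     (\<forall>x\<in>F. \<forall>y\<in>F. x + y \<in> F) \<and> (\<forall>x\<in>F. \<forall>y\<in>F. x * y \<in> F)"

text \<open>
  The field \<open>\<rat>(S)\<close>: over a field of characteristic 0 every subfield contains \<open>\<rat>\<close>, so the
  smallest subfield containing \<open>S\<close> is the extension of \<open>\<rat>\<close> generated by \<open>S\<close>.
\<close>
definition rat_adjoin :: "'a::field_char_0 set \<Rightarrow> 'a set" where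
  "rat_adjoin S = is_subfield hull S"

definition ring_of_integers :: "'a::field_char_0 set \<Rightarrow> 'a set" where
  "ring_of_integers K = {x \<in> K. algebraic_int x}"

text \<open>Below, the commutative ring is given as a subring \<open>R\<close> of an ambient commutative ring.\<close>

definition sums_of_squares :: "'a::comm_ring_1 set \<Rightarrow> 'a set" where
  "sums_of_squares R = {(\<Sum>i<n. (x i)\<^sup>2) | (n::nat) x. \<forall>i<n. x i \<in> R}"

definition sums_of_at_most_squares :: "enat \<Rightarrow> 'a::comm_ring_1 set \<Rightarrow> 'a set" where
  "sums_of_at_most_squares m R =
     {(\<Sum>i<n. (x i)\<^sup>2) | (n::nat) x. enat n \<le> m \<and> (\<forall>i<n. x i \<in> R)}"

definition pythagoras_number :: "'a::comm_ring_1 set \<Rightarrow> enat" where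
  "pythagoras_number R = Inf {m. sums_of_squares R = sums_of_at_most_squares m R}"

end

theory Submission
  imports Defs
begin

text \<open>
  Write \<open>K = \<rat>(\<surd>(b c), \<surd>(a c), \<surd>(a b))\<close> with \<open>a, b, c\<close> pairwise coprime. In each case modulo 4 there are
  integers \<open>\<beta>, \<gamma>\<close> of \<open>K\<close> such that \<open>\<alpha> = 7 + \<beta>\<^sup>2 + \<gamma>\<^sup>2\<close> is not a sum of five squares. Suppose it were, and
  collect the coordinates of the five summands with respect to \<open>1, \<surd>(b c), \<surd>(a c), \<surd>(a b)\<close> into vectors
  \<open>A, B, C, D \<in> \<int>\<^sup>5\<close>. The trace of \<open>\<alpha>\<close> bounds \<open>|A|\<^sup>2 + b c |B|\<^sup>2 + a c |C|\<^sup>2 + a b |D|\<^sup>2\<close>, the other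
  coordinates of \<open>\<alpha>\<close> prescribe combinations of inner products, and integrality prescribes
  parities. Because the radicands are not small, this forces \<open>D = 0\<close> or \<open>|D| = 1\<close> and makes the two
  non-rational parts of the summands those of \<open>\<beta>\<close> and \<open>\<gamma>\<close>. The remaining three summands are
  then rational integers whose squares add up to 7, which is impossible.
\<close>

section \<open>Inner products of integer vectors of length five\<close>

text \<open>The number 7 is the least one that needs four squares. It remains out of reach once two
  of five summands are used up, while \<open>7 = 4 + 1 + 1 + 1\<close> makes \<alpha> a sum of six
  squares. The excluded square roots enter through size only. The three radicands are square-free
  and exceed 1, so excluding 2, 3, 5, 6, 7 makes each at least 10. This is just enough for every
  deviation from the intended solution to overrun the trace equation. The radicand 13 is an
  additional exception: if one parameter is 1 and a radicand is 1 modulo 4, the estimates require at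
  least 17. The obstacle is that no single pair \<beta>, \<gamma> suits all fields. The pair must be
  cheap for the trace, so it exploits the denominators that integrality allows and, except for type
  B2, includes a cheap radicand; at the same time its inner products must not admit accidental
  solutions. Such solutions become conceivable when differences like \<open>a - b\<close> are as
  small as 4, and these cases need separate arguments. The condition is symmetric in
  \<open>a, b, c\<close>, so few orderings have to be treated.\<close>

definition dot :: "(nat \<Rightarrow> int) \<Rightarrow> (nat \<Rightarrow> int) \<Rightarrow> int" where
  "dot X Y = (\<Sum>i<5. X i * Y i)"

lemma dot_commute: "dot X Y = dot Y X"
  by (simp add: dot_def mult.commute)

lemma dot_self_nonneg: "0 \<le> dot X X"
  by (simp add: dot_def sum_nonneg)

lemma dot_self_eq_0D: "dot X X = 0 \<Longrightarrow> i < 5 \<Longrightarrow> X i = 0"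
  using sum_nonneg_eq_0_iff[of "{..<5::nat}" "\<lambda>i. X i * X i"] by (auto simp: dot_def)

lemma dot_eq_0_left: "dot X X = 0 \<Longrightarrow> dot X Y = 0"
  unfolding dot_def[of X Y] by (rule sum.neutral) (auto dest: dot_self_eq_0D)

lemma dot_eq_0_right: "dot X X = 0 \<Longrightarrow> dot Y X = 0"
  using dot_eq_0_left[of X Y] by (simp add: dot_commute)

lemma dot_remove:
  assumes "i < 5"
  shows "dot X Y = X i * Y i + (\<Sum>l\<in>{..<5} - {i}. X l * Y l)"
  unfolding dot_def using assms by (simp add: sum.remove)

lemma dot_remove2:
  assumes "i < 5" "j < 5" "i \<noteq> j"
  shows "dot X Y = X i * Y i + X j * Y j + (\<Sum>l\<in>{..<5} - {i, j}. X l * Y l)"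
proof -
  have "(\<Sum>l\<in>{..<5} - {i}. X l * Y l) = X j * Y j + (\<Sum>l\<in>{..<5} - {i} - {j}. X l * Y l)"
    using assms by (intro sum.remove) auto
  moreover have "{..<5} - {i} - {j} = {..<5} - {i, j}" by auto
  ultimately show ?thesis using dot_remove[OF assms(1), of X Y] by simp
qed

lemma dot_single:
  assumes "i < 5" "\<forall>l<5. l \<noteq> i \<longrightarrow> X l = 0"
  shows "dot X Y = X i * Y i" "dot Y X = Y i * X i"
  using dot_remove[OF assms(1)] assms(2) by simp_all

lemma dot_pair:
  assumes "i < 5" "j < 5" "i \<noteq> j" "\<forall>l<5. l \<noteq> i \<longrightarrow> l \<noteq> j \<longrightarrow> X l = 0"
  shows "dot X Y = X i * Y i + X j * Y j" "dot Y X = Y i * X i + Y j * X j"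
  using dot_remove2[OF assms(1-3)] assms(4) by simp_all

lemma square_le_imp_unit:
  fixes x :: int
  assumes "x * x \<le> 3" "x \<noteq> 0"
  shows "x = 1 \<or> x = -1"
proof -
  have "\<bar>x\<bar> < 2"
  proof (rule ccontr)
    assume "\<not> \<bar>x\<bar> < 2"
    then have "2 * 2 \<le> \<bar>x\<bar> * \<bar>x\<bar>" by (intro mult_mono) auto
    with assms(1) show False by (simp add: abs_mult_self_eq)
  qed
  with assms(2) show ?thesis by auto
qed

lemma dot_self_eq_1E:
  assumes "dot X X = 1"
  obtains i where "i < 5" "X i = 1 \<or> X i = -1" "\<forall>l<5. l \<noteq> i \<longrightarrow> X l = 0"
proof -
  have "\<exists>i<5. X i \<noteq> 0"
    using assms unfolding dot_def by (rule_tac ccontr) simp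
  then obtain i where i: "i < 5" "X i \<noteq> 0" by blast
  let ?S = "\<Sum>l\<in>{..<5} - {i}. X l * X l"
  have S: "?S \<ge> 0" by (intro sum_nonneg) simp
  have eq: "X i * X i + ?S = 1" using dot_remove[OF i(1), of X X] assms by simp
  have u: "X i = 1 \<or> X i = -1" using square_le_imp_unit[OF _ i(2)] eq S by auto
  then have "?S = 0" using eq by auto
  then have "\<forall>l\<in>{..<5} - {i}. X l * X l = 0"
    by (subst (asm) sum_nonneg_eq_0_iff) auto
  then show thesis using that[OF i(1) u] by auto
qed

lemma dot_self_eq_2E:
  assumes "dot X X = 2"
  obtains i j where "i < 5" "j < 5" "i \<noteq> j" "X i = 1 \<or> X i = -1" "X j = 1 \<or> X j = -1"
    "\<forall>l<5. l \<noteq> i \<longrightarrow> l \<noteq> j \<longrightarrow> X l = 0"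
proof -
  have "\<exists>i<5. X i \<noteq> 0"
    using assms unfolding dot_def by (rule_tac ccontr) simp
  then obtain i where i: "i < 5" "X i \<noteq> 0" by blast
  let ?S = "\<Sum>l\<in>{..<5} - {i}. X l * X l"
  have S: "?S \<ge> 0" by (intro sum_nonneg) simp
  have eq: "X i * X i + ?S = 2" using dot_remove[OF i(1), of X X] assms by simp
  have u: "X i = 1 \<or> X i = -1" using square_le_imp_unit[OF _ i(2)] eq S by auto
  define Y where "Y = X(i := 0)"
  have "dot Y Y = ?S" using dot_remove[OF i(1), of Y Y] by (simp add: Y_def)
  also have "?S = 1" using eq u by auto
  finally obtain j where j: "j < 5" "Y j = 1 \<or> Y j = -1" "\<forall>l<5. l \<noteq> j \<longrightarrow> Y l = 0"
    by (rule dot_self_eq_1E) blast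
  have "j \<noteq> i" using j(2) by (auto simp: Y_def)
  moreover have "\<forall>l<5. l \<noteq> i \<longrightarrow> l \<noteq> j \<longrightarrow> X l = 0" using j(3) by (metis Y_def fun_upd_other)
  moreover have "X j = 1 \<or> X j = -1" using j(2) \<open>j \<noteq> i\<close> by (simp add: Y_def)
  ultimately show thesis using that[OF i(1) j(1) _ u] by blast
qed

text \<open>Integrality of the summands is available only as congruences between coordinate vectors;
  this carries them over to inner products.\<close>

lemma dot_cong_parity:
  assumes "\<And>i. i < 5 \<Longrightarrow> even (X i + Y i)"
  shows "even (dot Z X + dot Z Y)"
proof -
  have "dot Z X + dot Z Y = (\<Sum>i<5. Z i * (X i + Y i))"
    by (simp add: dot_def sum.distrib distrib_left)
  then show ?thesis using assms by (auto intro!: dvd_sum)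
qed

lemma dot_self_parity: "even (dot X Y + dot X X)" if "\<And>i. i < 5 \<Longrightarrow> even (X i + Y i)"
  using dot_cong_parity[of Y X X] that by (simp add: add.commute)

lemma dot_self_cong_4:
  assumes "\<And>i. i < 5 \<Longrightarrow> even (X i + Y i)"
  shows "4 dvd dot X X - dot Y Y"
proof -
  have "4 dvd X i * X i - Y i * Y i" if "i < 5" for i
  proof -
    have "X i * X i - Y i * Y i = (X i + Y i) * (X i - Y i)" by (simp add: algebra_simps)
    moreover have "even (X i + Y i)" "even (X i - Y i)" using assms[OF that] by presburger+
    ultimately show ?thesis using mult_dvd_mono[of 2 "X i + Y i" 2 "X i - Y i"] by simp
  qed
  then have "4 dvd (\<Sum>i<5. X i * X i - Y i * Y i)" by (intro dvd_sum) auto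
  then show ?thesis by (simp add: dot_def sum_subtractf)
qed

section \<open>Squares modulo 8 and the number 7\<close>

lemma square_mod_8: "(x * x) mod 8 \<in> {0, 1, 4}" for x :: int
proof -
  have "x mod 8 \<in> {0, 1, 2, 3, 4, 5, 6, 7}"
    using pos_mod_bound[of 8 x] pos_mod_sign[of 8 x] by auto
  moreover have "(x * x) mod 8 = ((x mod 8) * (x mod 8)) mod 8" by (simp add: mod_mult_eq)
  ultimately show ?thesis by auto
qed

lemma three_squares_neq_7: "x * x + y * y + z * z \<noteq> 7" for x y z :: int
proof
  assume h: "x * x + y * y + z * z = 7"
  have "((x * x) mod 8 + (y * y) mod 8 + (z * z) mod 8) mod 8 = (x * x + y * y + z * z) mod 8"
    by (metis mod_add_eq mod_add_left_eq)
  then have "((x * x) mod 8 + (y * y) mod 8 + (z * z) mod 8) mod 8 = 7" using h by simp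
  then show False using square_mod_8[of x] square_mod_8[of y] square_mod_8[of z] by auto
qed

text \<open>Two of the five entries are reserved for the summands with irrational part; the three
  others are too few squares for 7. The intended branch of every case ends in this
  contradiction.\<close>

lemma rest_neq_7:
  assumes "i < 5" "j < 5" "i \<noteq> j"
  shows "dot X X \<noteq> X i * X i + X j * X j + 7"
proof -
  have "card ({..<5} - {i, j}) = 3" using assms by (simp add: card_Diff_subset)
  then obtain x y z where "{..<5} - {i, j} = {x, y, z}" "x \<noteq> y" "x \<noteq> z" "y \<noteq> z"
    by (auto simp: card_3_iff)
  then have "(\<Sum>l\<in>{..<5} - {i, j}. X l * X l) = X x * X x + X y * X y + X z * X z" by simp
  then show ?thesis using dot_remove2[OF assms, of X X] three_squares_neq_7[of "X x" "X y" "X z"]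
    by simp
qed

text \<open>The number 7 appears as \<open>28 = 4 * 7\<close> when coordinates are measured in
  halves; evenness of the three remaining entries allows the factor 4 to be removed.\<close>

lemma rest_neq_28:
  assumes "i < 5" "j < 5" "i \<noteq> j" and ev: "\<forall>l<5. l \<noteq> i \<longrightarrow> l \<noteq> j \<longrightarrow> even (X l)"
  shows "dot X X \<noteq> X i * X i + X j * X j + 28"
proof
  assume h: "dot X X = X i * X i + X j * X j + 28"
  define Y where "Y l = X l div 2" for l
  have "(\<Sum>l\<in>{..<5} - {i, j}. X l * X l) = (\<Sum>l\<in>{..<5} - {i, j}. 4 * (Y l * Y l))"
    using ev by (intro sum.cong) (auto simp: Y_def elim!: evenE)
  then have "4 * (\<Sum>l\<in>{..<5} - {i, j}. Y l * Y l) = 28"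
    using dot_remove2[OF assms(1-3), of X X] h by (simp add: sum_distrib_left)
  then show False using dot_remove2[OF assms(1-3), of Y Y] rest_neq_7[OF assms(1-3), of Y] by simp
qed

text \<open>A prescribed inner product bounds the norms from below. This serves where the trace
  equation alone does not exclude a norm.\<close>

lemma dot_self_ge_4_mult: "4 * dot X Y \<le> dot X X + 4 * dot Y Y"
proof -
  have "dot X X + 4 * dot Y Y - 4 * dot X Y = (\<Sum>i<5. (X i - 2 * Y i) * (X i - 2 * Y i))"
    by (simp add: dot_def sum_distrib_left sum.distrib[symmetric] sum_subtractf[symmetric] algebra_simps)
  also have "\<dots> \<ge> 0" by (intro sum_nonneg) simp
  finally show ?thesis by simp
qed

lemma dot_even_right:
  assumes "\<And>i. i < 5 \<Longrightarrow> even (X i)"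
  shows "even (dot Y X)"
  using assms unfolding dot_def by (auto intro!: dvd_sum)

text \<open>Vectors that agree modulo 2 have the same odd positions, and a vector of norm 2 is
  determined by these up to signs.\<close>

lemma dot_self_eq_2_common_supportE:
  assumes "dot X X = 2" "dot Y Y = 2" and par: "\<And>i. i < 5 \<Longrightarrow> even (X i + Y i)"
  obtains i j where "i < 5" "j < 5" "i \<noteq> j" "X i = 1 \<or> X i = -1" "X j = 1 \<or> X j = -1"
    "Y i = 1 \<or> Y i = -1" "Y j = 1 \<or> Y j = -1"
    "\<forall>l<5. l \<noteq> i \<longrightarrow> l \<noteq> j \<longrightarrow> X l = 0" "\<forall>l<5. l \<noteq> i \<longrightarrow> l \<noteq> j \<longrightarrow> Y l = 0"
proof -
  from assms(1) obtain i j where ij: "i < 5" "j < 5" "i \<noteq> j" and Xi: "X i = 1 \<or> X i = -1"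
    and Xj: "X j = 1 \<or> X j = -1" and Xl: "\<forall>l<5. l \<noteq> i \<longrightarrow> l \<noteq> j \<longrightarrow> X l = 0"
    by (rule dot_self_eq_2E) blast
  from assms(2) obtain i' j' where ij': "i' < 5" "j' < 5" "i' \<noteq> j'" and Yi: "Y i' = 1 \<or> Y i' = -1"
    and Yj: "Y j' = 1 \<or> Y j' = -1" and Yl: "\<forall>l<5. l \<noteq> i' \<longrightarrow> l \<noteq> j' \<longrightarrow> Y l = 0"
    by (rule dot_self_eq_2E) blast
  have "i \<in> {i', j'}"
  proof (rule ccontr)
    assume "i \<notin> {i', j'}"
    then show False using par[of i] Xi Yl ij by auto
  qed
  moreover have "j \<in> {i', j'}"
  proof (rule ccontr)
    assume "j \<notin> {i', j'}"
    then show False using par[of j] Xj Yl ij by auto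
  qed
  ultimately have "(i' = i \<and> j' = j) \<or> (i' = j \<and> j' = i)" using ij(3) by auto
  then show thesis using that[OF ij Xi Xj _ _ Xl] Yi Yj Yl by blast
qed

lemma dot_self_eq_1_common_supportE:
  assumes "dot X X = 1" "dot Y Y = 1" and par: "\<And>i. i < 5 \<Longrightarrow> even (X i + Y i)"
  obtains i where "i < 5" "X i = 1 \<or> X i = -1" "Y i = 1 \<or> Y i = -1"
    "\<forall>l<5. l \<noteq> i \<longrightarrow> X l = 0" "\<forall>l<5. l \<noteq> i \<longrightarrow> Y l = 0"
proof -
  from assms(1) obtain i where i: "i < 5" and Xi: "X i = 1 \<or> X i = -1"
    and Xl: "\<forall>l<5. l \<noteq> i \<longrightarrow> X l = 0"
    by (rule dot_self_eq_1E) blast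
  from assms(2) obtain j where j: "j < 5" and Yj: "Y j = 1 \<or> Y j = -1"
    and Yl: "\<forall>l<5. l \<noteq> j \<longrightarrow> Y l = 0"
    by (rule dot_self_eq_1E) blast
  have "i = j"
  proof (rule ccontr)
    assume "i \<noteq> j"
    then show False using par[of i] Xi Yl i by auto
  qed
  then show thesis using that[OF i Xi _ Xl] Yj Yl by blast
qed

lemma dot_double:
  assumes "\<And>l. l < 5 \<Longrightarrow> X l = 2 * X' l"
  shows "dot X Y = 2 * dot X' Y" "dot Y X = 2 * dot Y X'"
proof -
  show *: "dot X Y = 2 * dot X' Y" for Y
    using assms by (simp add: dot_def sum_distrib_left mult.assoc)
  show "dot Y X = 2 * dot Y X'" using *[of Y] by (simp add: dot_commute)
qed

section \<open>Systems of quadratic equations without solutions\<close>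

text \<open>
  The types refer to residues modulo 4. Type A: \<open>a \<equiv> b \<equiv> c\<close> odd, with quarters \<open>(A + B\<surd>(b c) + C\<surd>(a c) + D\<surd>(a b))/4\<close>
  as coordinates. Type B1: \<open>a \<equiv> b\<close> odd and \<open>c\<close> not congruent to \<open>a\<close>; type B2: \<open>c\<close> even and \<open>a b \<equiv> 3\<close>; both with halves
  as coordinates. The equations say that five squares add up to one of
  \<^item> B2: \<open>7 + ((\<surd>(b c) + \<surd>(a c))/2)\<^sup>2 + (1 + (\<surd>(b c) - \<surd>(a c))/2)\<^sup>2\<close>
  \<^item> B1, \<open>b = 1\<close>: \<open>7 + ((1 + \<surd>(a b))/2)\<^sup>2 + (1 + \<surd>(b c))\<^sup>2\<close>
  \<^item> B1, \<open>1 < b < c\<close>: \<open>7 + ((1 + \<surd>(a b))/2)\<^sup>2 + (1 + (\<surd>(b c) + \<surd>(a c))/2)\<^sup>2\<close>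
  \<^item> B1, \<open>c < b\<close>: \<open>7 + (1 + (\<surd>(b c) + \<surd>(a c))/2)\<^sup>2 + (2 + (\<surd>(a c) - \<surd>(b c))/2)\<^sup>2\<close>
  \<^item> A, \<open>c < b < a\<close>: \<open>7 + ((t + \<surd>(b c))/2)\<^sup>2 + ((1 + \<surd>(a c))/2)\<^sup>2\<close> with \<open>t = 1\<close> if \<open>c = 1\<close> and \<open>t = 3\<close> otherwise
\<close>

lemma no_solution_type_B2:
  fixes a b c m n s k :: int
  assumes m: "m > 8" and n: "n > 8" and s: "s > 8" and c: "c = 2 * k" "odd k"
    and par: "\<And>i. i < 5 \<Longrightarrow> even (B i + C i)"
    and e0: "4 * dot A A + m * dot B B + n * dot C C + 4 * s * dot D D = 32 + 2 * m + 2 * n"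
    and e1: "dot A B + a * dot C D = 1"
    and e2: "dot A C + b * dot B D = -1"
    and e3: "4 * dot A D + c * dot B C = 0"
  shows False
proof -
  note nonneg = dot_self_nonneg[of A] dot_self_nonneg[of B] dot_self_nonneg[of C] dot_self_nonneg[of D]
  have "2 * dot A D = - k * dot B C" using e3 c by simp
  then have BC: "even (dot B C)" using c(2) by (metis dvd_triv_left even_minus even_mult_iff)
  have evB: "even (dot B B)" using BC dot_self_parity[OF par] by simp
  have cong: "4 dvd dot B B - dot C C" by (rule dot_self_cong_4[OF par])
  have evC: "even (dot C C)" using evB cong by presburger
  have B0: "dot B B \<noteq> 0"
  proof
    assume z: "dot B B = 0"
    then have "even (C i)" if "i < 5" for i using par[OF that] dot_self_eq_0D[OF z that] by simp
    then have "even (dot A C)" unfolding dot_def by (auto intro!: dvd_sum)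
    with e2 dot_eq_0_left[OF z] show False by simp
  qed
  have C0: "dot C C \<noteq> 0"
  proof
    assume z: "dot C C = 0"
    then have "even (B i)" if "i < 5" for i using par[OF that] dot_self_eq_0D[OF z that] by simp
    then have "even (dot A B)" unfolding dot_def by (auto intro!: dvd_sum)
    with e1 dot_eq_0_left[OF z] show False by simp
  qed
  have B2: "dot B B \<ge> 2" using B0 evB nonneg by presburger
  have C2: "dot C C \<ge> 2" using C0 evC nonneg by presburger
  have mB: "m * dot B B \<ge> m * 2" using m B2 by (intro mult_left_mono) auto
  have nC: "n * dot C C \<ge> n * 2" using n C2 by (intro mult_left_mono) auto
  \<comment> \<open>\<open>B\<close> and \<open>C\<close> already consume
    \<open>2 * m + 2 * n\<close>, which leaves 32, while a nonzero \<open>D\<close> costs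
    \<open>4 * s\<close>. The thresholds 8 in the hypotheses are \<open>32 / 4\<close>.\<close>
  have D0: "dot D D = 0"
  proof (rule ccontr)
    assume "dot D D \<noteq> 0"
    then have "s * dot D D \<ge> s * 1" using s nonneg by (intro mult_left_mono) auto
    then show False using e0 mB nC nonneg s by linarith
  qed
  have e0': "4 * dot A A + m * dot B B + n * dot C C = 32 + 2 * m + 2 * n" using e0 D0 by simp
  have BC0: "dot B C = 0" using e3 c dot_eq_0_right[OF D0] by auto
  have BB: "dot B B = 2"
  proof (rule ccontr)
    assume "dot B B \<noteq> 2"
    then have "dot B B = 4 \<and> dot C C \<ge> 4 \<or> dot B B \<ge> 6" using B2 C2 evB cong by presburger
    then consider "dot B B = 4" "dot C C \<ge> 4" | "dot B B \<ge> 6" by blast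
    then show False
    proof cases
      case 1
      then have "n * dot C C \<ge> n * 4" using n by (intro mult_left_mono) auto
      moreover have "m * dot B B = m * 4" using 1(1) by simp
      ultimately show False using e0' nonneg m n by linarith
    next
      case 2
      then have "m * dot B B \<ge> m * 6" using m by (intro mult_left_mono) auto
      then show False using e0' nC nonneg m by linarith
    qed
  qed
  have CC: "dot C C = 2"
  proof (rule ccontr)
    assume "dot C C \<noteq> 2"
    then have "dot C C \<ge> 6" using BB C2 cong by presburger
    then have "n * dot C C \<ge> n * 6" using n by (intro mult_left_mono) auto
    then show False using e0' mB nonneg n by linarith
  qed
  have AA: "dot A A = 8" using e0 BB CC D0 by simp
  from BB CC par obtain i j where ij: "i < 5" "j < 5" "i \<noteq> j"
    and u: "B i = 1 \<or> B i = -1" "B j = 1 \<or> B j = -1" "C i = 1 \<or> C i = -1" "C j = 1 \<or> C j = -1"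
    and Bl: "\<forall>l<5. l \<noteq> i \<longrightarrow> l \<noteq> j \<longrightarrow> B l = 0"
    and Cl: "\<forall>l<5. l \<noteq> i \<longrightarrow> l \<noteq> j \<longrightarrow> C l = 0"
    by (rule dot_self_eq_2_common_supportE) blast
  have "A i * B i + A j * B j = 1" using e1 dot_eq_0_right[OF D0] dot_pair(2)[OF ij Bl] by simp
  moreover have "A i * C i + A j * C j = -1"
    using e2 dot_eq_0_right[OF D0] dot_pair(2)[OF ij Cl] by simp
  moreover have "B i * C i + B j * C j = 0" using BC0 dot_pair(1)[OF ij Bl] by simp
  \<comment> \<open>As \<open>B\<close> and \<open>C\<close> are orthogonal sign vectors, one of
    them is \<plusminus>(1, 1) and the other \<plusminus>(1, -1); up to sign and order,
    \<open>A\<close> must then be (0, 1), the rational parts of \<beta> and \<gamma>.\<close>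
  ultimately have "(A i = 0 \<and> (A j = 1 \<or> A j = -1)) \<or> (A j = 0 \<and> (A i = 1 \<or> A i = -1))"
    using u by (elim disjE) simp_all
  then have "A i * A i + A j * A j = 1" by auto
  then show False using AA rest_neq_7[OF ij, of A] by simp
qed

text \<open>With \<open>b = 1\<close> the radicands are \<open>c\<close>, \<open>a * c\<close> and
  \<open>a\<close>. In doubled coordinates \<beta> contributes \<open>1 + a\<close> and \<gamma>
  contributes \<open>4 + 4 * c\<close>, so \<open>33 = 28 + 1 + 4\<close>.\<close>

lemma no_solution_type_B1_unit:
  fixes a c :: int
  assumes a: "a \<ge> 17" and c: "c \<ge> 10"
    and parAD: "\<And>i. i < 5 \<Longrightarrow> even (A i + D i)"
    and parBC: "\<And>i. i < 5 \<Longrightarrow> even (B i + C i)"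
    and e0: "dot A A + c * dot B B + a * c * dot C C + a * dot D D = 33 + a + 4 * c"
    and e1: "dot A B + a * dot C D = 4"
    and e2: "dot A C + dot B D = 0"
    and e3: "dot A D + c * dot B C = 1"
  shows False
proof -
  note nonneg = dot_self_nonneg[of A] dot_self_nonneg[of B] dot_self_nonneg[of C] dot_self_nonneg[of D]
  have cB: "c * dot B B \<ge> 0" and aD: "a * dot D D \<ge> 0" using a c nonneg by auto
  have C0: "dot C C = 0"
  proof (rule ccontr)
    assume "dot C C \<noteq> 0"
    then have "a * c * dot C C \<ge> a * c * 1" using a c nonneg by (intro mult_left_mono) auto
    \<comment> \<open>Expanded, this is \<open>a * c \<ge> 113 + a + 4 * c\<close>, so a nonzero
      \<open>C\<close> alone exceeds the right-hand side of \<open>e0\<close>.\<close>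
    moreover have "(a - 4) * (c - 1) \<ge> 13 * 9" using a c by (intro mult_mono) auto
    ultimately show False using e0 nonneg cB aD by (simp add: algebra_simps)
  qed
  have BD: "dot B D = 0" and AB: "dot A B = 4" and AD: "dot A D = 1"
    using e1 e2 e3 dot_eq_0_left[OF C0] dot_eq_0_right[OF C0] by auto
  have evB: "\<And>i. i < 5 \<Longrightarrow> even (B i)" using parBC dot_self_eq_0D[OF C0] by fastforce
  have B4: "4 dvd dot B B" using dot_self_cong_4[of B C] parBC C0 by simp
  have "dot B B \<noteq> 0" using AB dot_eq_0_right[of B A] by auto
  then have B4': "dot B B \<ge> 4" using B4 nonneg by presburger
  have "even (dot D A + dot D D)" using parAD by (intro dot_self_parity) (simp add: add.commute)
  then have oD: "odd (dot D D)" using AD by (simp add: dot_commute)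
  then have D1: "dot D D \<ge> 1" using nonneg by presburger
  have BB: "dot B B = 4"
  proof (rule ccontr)
    assume "dot B B \<noteq> 4"
    then have "dot B B \<ge> 8" using B4 B4' by presburger
    then have "c * dot B B \<ge> c * 8" using c by (intro mult_left_mono) auto
    moreover have "a * dot D D \<ge> a * 1" using a D1 by (intro mult_left_mono) auto
    moreover have "a * c * dot C C = 0" using C0 by simp
    ultimately show False using e0 nonneg c by linarith
  qed
  have DD: "dot D D = 1"
  proof (rule ccontr)
    assume "dot D D \<noteq> 1"
    then have "dot D D \<ge> 3" using oD D1 by presburger
    then have "a * dot D D \<ge> a * 3" using a by (intro mult_left_mono) auto
    moreover have "a * c * dot C C = 0" "c * dot B B = 4 * c" using C0 BB by simp_all
    ultimately show False using e0 nonneg a by linarith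
  qed
  have AA: "dot A A = 33" using e0 C0 BB DD by simp
  define B' where "B' l = B l div 2" for l
  have B': "B l = 2 * B' l" if "l < 5" for l using evB[OF that] by (simp add: B'_def)
  have "dot B' B' = 1" and AB': "dot A B' = 2" and BD': "dot B' D = 0"
    using BB AB BD dot_double[of B B', OF B'] by auto
  then obtain i where i: "i < 5" "B' i = 1 \<or> B' i = -1" "\<forall>l<5. l \<noteq> i \<longrightarrow> B' l = 0"
    by (elim dot_self_eq_1E) blast
  from DD obtain j where j: "j < 5" "D j = 1 \<or> D j = -1" "\<forall>l<5. l \<noteq> j \<longrightarrow> D l = 0"
    by (rule dot_self_eq_1E) blast
  have "B' i * D i = 0" using dot_single(1)[OF i(1,3)] BD' by simp
  then have "i \<noteq> j" using i(2) j(2) by auto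
  have "A i * B' i = 2" using dot_single(2)[OF i(1,3)] AB' by simp
  then have "A i = 2 \<or> A i = -2" using i(2) by auto
  moreover have "A j * D j = 1" using dot_single(2)[OF j(1,3)] AD by simp
  then have "A j = 1 \<or> A j = -1" using j(2) by auto
  ultimately have "A i * A i + A j * A j = 5" by auto
  moreover have "\<forall>l<5. l \<noteq> i \<longrightarrow> l \<noteq> j \<longrightarrow> even (A l)" using parAD j(3) by fastforce
  ultimately show False using rest_neq_28[OF i(1) j(1) \<open>i \<noteq> j\<close>, of A] AA by auto
qed

text \<open>The right-hand sides 2, 2 and \<open>1 + c\<close> are not divisible by
  \<open>a\<close>, \<open>b\<close> and \<open>c\<close> respectively, so none of \<open>B\<close>,
  \<open>C\<close>, \<open>D\<close> can vanish. All three radicands are then paid for once, and the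
  remaining 33 hardly allows more.\<close>

lemma no_solution_type_B1_large:
  fixes a b c m n s :: int
  assumes b: "b \<ge> 3" and a: "a \<ge> b + 4" and c: "c > b"
    and mns: "m = b * c" "n = a * c" "s = a * b"
    and parAD: "\<And>i. i < 5 \<Longrightarrow> even (A i + D i)"
    and parBC: "\<And>i. i < 5 \<Longrightarrow> even (B i + C i)"
    and e0: "dot A A + m * dot B B + n * dot C C + s * dot D D = 33 + s + m + n"
    and e1: "dot A B + a * dot C D = 2"
    and e2: "dot A C + b * dot B D = 2"
    and e3: "dot A D + c * dot B C = 1 + c"
  shows False
proof -
  note nonneg = dot_self_nonneg[of A] dot_self_nonneg[of B] dot_self_nonneg[of C] dot_self_nonneg[of D]
  have m: "m \<ge> 12" unfolding mns using mult_mono[of 3 b 4 c] b c by simp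
  have n: "n \<ge> 28" unfolding mns using mult_mono[of 7 a 4 c] a b c by simp
  have s: "s \<ge> 21" unfolding mns using mult_mono[of 7 a 3 b] a b by simp
  have D0: "dot D D \<noteq> 0"
  proof
    assume z: "dot D D = 0"
    then have "c * (dot B C - 1) = 1" using e3 dot_eq_0_right[OF z] by (simp add: algebra_simps)
    then have "c dvd 1" by (metis dvd_triv_left)
    then show False using b c by (simp add: zdvd_not_zless)
  qed
  have C0: "dot C C \<noteq> 0"
  proof
    assume z: "dot C C = 0"
    then have "b * dot B D = 2" using e2 dot_eq_0_right[OF z] by simp
    then have "b dvd 2" by (metis dvd_triv_left)
    then show False using b zdvd_imp_le by fastforce
  qed
  have B0: "dot B B \<noteq> 0"
  proof
    assume z: "dot B B = 0"
    then have "a * dot C D = 2" using e1 dot_eq_0_right[OF z] by simp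
    then have "a dvd 2" by (metis dvd_triv_left)
    then show False using a b zdvd_imp_le by fastforce
  qed
  have mB: "m * dot B B \<ge> m * 1" using m B0 nonneg by (intro mult_left_mono) auto
  have nC: "n * dot C C \<ge> n * 1" using n C0 nonneg by (intro mult_left_mono) auto
  have sD: "s * dot D D \<ge> s * 1" using s D0 nonneg by (intro mult_left_mono) auto
  have cong: "4 dvd dot B B - dot C C" by (rule dot_self_cong_4[OF parBC])
  have CC: "dot C C = 1"
  proof (rule ccontr)
    assume "dot C C \<noteq> 1"
    then have "dot C C \<ge> 3 \<or> dot C C = 2 \<and> dot B B \<ge> 2" using C0 B0 cong nonneg by presburger
    then show False
    proof
      assume "dot C C \<ge> 3"
      then have "n * dot C C \<ge> n * 3" using n by (intro mult_left_mono) auto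
      then show False using e0 mB sD nonneg n by linarith
    next
      assume *: "dot C C = 2 \<and> dot B B \<ge> 2"
      then have "m * dot B B \<ge> m * 2" using m by (intro mult_left_mono) auto
      moreover have "n * dot C C = n * 2" using * by simp
      ultimately show False using e0 sD nonneg m n by linarith
    qed
  qed
  have BB: "dot B B = 1"
  proof (rule ccontr)
    assume "dot B B \<noteq> 1"
    then have "dot B B \<ge> 5" using B0 cong CC nonneg by presburger
    then have "m * dot B B \<ge> m * 5" using m by (intro mult_left_mono) auto
    then show False using e0 nC sD nonneg m by linarith
  qed
  have e0': "dot A A + s * dot D D = 33 + s" using e0 BB CC by simp
  have D2: "dot D D \<le> 2"
  proof (rule ccontr)
    assume "\<not> dot D D \<le> 2"
    then have "s * dot D D \<ge> s * 3" using s by (intro mult_left_mono) auto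
    then show False using e0' nonneg s by linarith
  qed
  from BB CC parBC obtain i where i: "i < 5" and u: "B i = 1 \<or> B i = -1" "C i = 1 \<or> C i = -1"
    and Bl: "\<forall>l<5. l \<noteq> i \<longrightarrow> B l = 0" and Cl: "\<forall>l<5. l \<noteq> i \<longrightarrow> C l = 0"
    by (rule dot_self_eq_1_common_supportE) blast
  have f1: "A i * B i + a * (C i * D i) = 2" using e1 dot_single[OF i Bl] dot_single[OF i Cl] by simp
  have f2: "A i * C i + b * (B i * D i) = 2" using e2 dot_single[OF i Bl] dot_single[OF i Cl] by simp
  have f3: "dot A D + c * (B i * C i) = 1 + c" using e3 dot_single[OF i Bl] by simp
  \<comment> \<open>Equal signs are the pattern of \<gamma>. Opposite signs are an accidental
    branch: it forces \<open>a = b + 4\<close>, and then \<open>e3\<close> fails.\<close>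
  show False
  proof (cases "B i = C i")
    case True
    have "(a - b) * (C i * D i) = (A i * C i + a * (C i * D i)) - (A i * C i + b * (C i * D i))"
      by (simp only: algebra_simps)
    then have "(a - b) * (C i * D i) = 0" using f1[unfolded True] f2[unfolded True] by linarith
    then have Di: "D i = 0" using a u by auto
    have "A i * B i = 2" using f1 Di by simp
    then have Ai: "A i = 2 \<or> A i = -2" using u by auto
    have AD: "dot A D = 1" using f3 True u by auto
    have "even (dot D A + dot D D)" using parAD by (intro dot_self_parity) (simp add: add.commute)
    then have "dot D D = 1" using AD D0 D2 nonneg by (simp add: dot_commute) presburger
    then obtain j where j: "j < 5" "D j = 1 \<or> D j = -1" "\<forall>l<5. l \<noteq> j \<longrightarrow> D l = 0"
      by (rule dot_self_eq_1E) blast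
    have "i \<noteq> j" using Di j by auto
    have "A j * D j = 1" using dot_single(2)[OF j(1,3)] AD by simp
    then have "A j = 1 \<or> A j = -1" using j(2) by auto
    with Ai have "A i * A i + A j * A j = 5" by auto
    moreover have "\<forall>l<5. l \<noteq> i \<longrightarrow> l \<noteq> j \<longrightarrow> even (A l)" using parAD j(3) by fastforce
    moreover have "dot A A = 33" using e0' \<open>dot D D = 1\<close> by simp
    ultimately show False using rest_neq_28[OF i(1) j(1) \<open>i \<noteq> j\<close>, of A] by auto
  next
    case False
    then have BC: "C i = - B i" using u by auto
    have BBi: "B i * B i = 1" using u by auto
    have "(b - a) * (B i * D i) = 4" using f1 f2 BC by (simp add: algebra_simps)
    moreover have "A i * B i = 2 + a * (B i * D i)" using f1 BC by (simp add: algebra_simps)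
    moreover define d where "d = B i * D i"
    ultimately have d: "(b - a) * d = 4" "A i * B i = 2 + a * d" by auto
    have "a - b dvd 4" using d(1) by (metis dvd_triv_left dvd_minus_iff minus_diff_eq dvd_mult2 minus_dvd_iff)
    then have ab: "a = b + 4" using a zdvd_imp_le[of "a - b" 4] by simp
    then have "d = -1" using d by simp
    then have Ai: "A i * B i = 2 - a" and Di: "B i * D i = -1" using d d_def by auto
    have "A i * A i = (A i * B i) * (A i * B i)" using BBi by (metis mult.assoc mult.commute mult.right_neutral)
    then have Ai2: "A i * A i = (a - 2) * (a - 2)" using Ai by (simp add: algebra_simps)
    have "A i * A i \<le> dot A A" using dot_remove[OF i, of A A] by (simp add: sum_nonneg)
    moreover have "(a - 2) * (a - 2) \<ge> 5 * 5" using a b by (intro mult_mono) auto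
    ultimately have AA: "dot A A \<ge> 25" using Ai2 by simp
    have DD: "dot D D = 1"
    proof (rule ccontr)
      assume "dot D D \<noteq> 1"
      then have "dot D D = 2" using D0 D2 nonneg by linarith
      then show False using e0' AA s by simp
    qed
    then obtain j where j: "j < 5" "D j = 1 \<or> D j = -1" "\<forall>l<5. l \<noteq> j \<longrightarrow> D l = 0"
      by (rule dot_self_eq_1E) blast
    have "D i \<noteq> 0" using Di by auto
    then have "i = j" using j(3) i by auto
    then have "dot A D = A i * D i" using dot_single(2)[OF j(1,3)] by simp
    also have "D i = - B i" using Di u by auto
    finally have "dot A D = a - 2" using Ai by simp
    \<comment> \<open>Combined with \<open>a = b + 4\<close> this says \<open>b + 1 = 2 * c\<close>,
      impossible for \<open>c > b\<close>.\<close>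
    moreover have "dot A D - c = 1 + c" using f3 BC BBi by simp
    ultimately show False using ab b c by linarith
  qed
qed

text \<open>For \<open>c < b < a\<close> the radicand \<open>a * b\<close> is the most expensive
  one; \<beta> and \<gamma> avoid it, so that \<open>D = 0\<close> is the intended branch. In
  doubled coordinates their rational parts are 2 and 4, whence
  \<open>48 = 28 + 4 + 16\<close>.\<close>

lemma no_solution_type_B1_small:
  fixes a b c m n s :: int
  assumes c0: "c \<ge> 1" and b: "b \<ge> 5" and a: "a \<ge> b + 4" and c: "c < b"
    and mns: "m = b * c" "n = a * c" "s = a * b" and m: "m \<ge> 10" and s: "s > 48"
    and parAD: "\<And>i. i < 5 \<Longrightarrow> even (A i + D i)"
    and parBC: "\<And>i. i < 5 \<Longrightarrow> even (B i + C i)"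
    and e0: "dot A A + m * dot B B + n * dot C C + s * dot D D = 48 + 2 * m + 2 * n"
    and e1: "dot A B + a * dot C D = -2"
    and e2: "dot A C + b * dot B D = 6"
    and e3: "dot A D + c * dot B C = 0"
  shows False
proof -
  note nonneg = dot_self_nonneg[of A] dot_self_nonneg[of B] dot_self_nonneg[of C] dot_self_nonneg[of D]
  have n: "n \<ge> m + 4"
  proof -
    have "(a - b) * c \<ge> 4 * 1" using a c0 by (intro mult_mono) auto
    then show ?thesis by (simp add: mns algebra_simps)
  qed
  have cong: "4 dvd dot B B - dot C C" by (rule dot_self_cong_4[OF parBC])
  have parBC': "even (dot B C + dot B B)" by (rule dot_self_parity[OF parBC])
  have B0: "dot B B \<noteq> 0"
  proof
    assume z: "dot B B = 0"
    then have "a * dot C D = -2" using e1 dot_eq_0_right[OF z] by simp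
    then have "a dvd 2" by (metis dvd_triv_left dvd_minus_iff)
    then show False using a b zdvd_imp_le by fastforce
  qed
  have DC0: "dot C C \<noteq> 0"
  proof
    assume z: "dot C C = 0"
    then have bd: "b * dot B D = 6" using e2 dot_eq_0_right[OF z] by simp
    have "even (B i)" if "i < 5" for i using parBC[OF that] dot_self_eq_0D[OF z that] by simp
    then have "even (dot D B)" by (rule dot_even_right)
    then obtain k where "dot B D = 2 * k" by (auto simp: dot_commute elim: evenE)
    then have "b * k = 3" using bd by simp
    then have "b dvd 3" by (metis dvd_triv_left)
    then show False using b zdvd_imp_le by fastforce
  qed
  show False
  proof (cases "dot D D = 0")
    case True
    have AB: "dot A B = -2" and AC: "dot A C = 6" and BC: "dot B C = 0"
      using e1 e2 e3 c0 dot_eq_0_right[OF True] by auto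
    have B2: "dot B B \<ge> 2" "even (dot B B)" using parBC' BC B0 nonneg by presburger+
    have C2: "dot C C \<ge> 2" "even (dot C C)" using B2(2) cong DC0 nonneg by presburger+
    have mB: "m * dot B B \<ge> m * 2" using m B2 by (intro mult_left_mono) auto
    have nC: "n * dot C C \<ge> n * 2" using m n C2 by (intro mult_left_mono) auto
    have e0': "dot A A + m * dot B B + n * dot C C = 48 + 2 * m + 2 * n" using e0 True by simp
    have CC: "dot C C = 2"
    proof (rule ccontr)
      assume "dot C C \<noteq> 2"
      then have "dot C C \<ge> 6 \<or> dot C C = 4 \<and> dot B B \<ge> 4" using C2 B2 cong by presburger
      then show False
      proof
        assume "dot C C \<ge> 6"
        then have "n * dot C C \<ge> n * 6" using n m by (intro mult_left_mono) auto
        then show False using e0' mB nonneg m n by linarith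
      next
        \<comment> \<open>The bounds \<open>m \<ge> 10\<close> and \<open>n \<ge> 14\<close> only
          yield \<open>A = 0\<close> here; the value 6 of \<open>dot A C\<close> has to finish the
          argument.\<close>
        assume *: "dot C C = 4 \<and> dot B B \<ge> 4"
        then have "m * dot B B \<ge> m * 4" using m by (intro mult_left_mono) auto
        moreover have "n * dot C C = n * 4" using * by simp
        ultimately have "dot A A \<le> 0" using e0' nonneg m n by linarith
        then have "dot A A = 0" using nonneg by simp
        then show False using AC dot_eq_0_left by fastforce
      qed
    qed
    have BB: "dot B B = 2"
    proof (rule ccontr)
      assume "dot B B \<noteq> 2"
      then have "dot B B \<ge> 6" using B2 CC cong by presburger
      then have "m * dot B B \<ge> m * 6" using m by (intro mult_left_mono) auto
      then have "dot A A \<le> 8" using e0' nC m by linarith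
      then show False using dot_self_ge_4_mult[of A C] AC CC by simp
    qed
    have AA: "dot A A = 48" using e0' BB CC by simp
    define A' where "A' l = A l div 2" for l
    have A': "A l = 2 * A' l" if "l < 5" for l
      using parAD[OF that] dot_self_eq_0D[OF True that] by (simp add: A'_def)
    have AA': "dot A' A' = 12" and AB': "dot A' B = -1" and AC': "dot A' C = 3"
      using AA AB AC dot_double[of A A', OF A'] by auto
    from BB CC parBC obtain i j where ij: "i < 5" "j < 5" "i \<noteq> j"
      and u: "B i = 1 \<or> B i = -1" "B j = 1 \<or> B j = -1" "C i = 1 \<or> C i = -1" "C j = 1 \<or> C j = -1"
      and Bl: "\<forall>l<5. l \<noteq> i \<longrightarrow> l \<noteq> j \<longrightarrow> B l = 0" and Cl: "\<forall>l<5. l \<noteq> i \<longrightarrow> l \<noteq> j \<longrightarrow> C l = 0"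
      by (rule dot_self_eq_2_common_supportE) blast
    have "A' i * B i + A' j * B j = -1" using AB' dot_pair(2)[OF ij Bl] by simp
    moreover have "A' i * C i + A' j * C j = 3" using AC' dot_pair(2)[OF ij Cl] by simp
    moreover have "B i * C i + B j * C j = 0" using BC dot_pair(1)[OF ij Bl] by simp
    ultimately have "(A' i = 1 \<or> A' i = -1) \<and> (A' j = 2 \<or> A' j = -2) \<or>
        (A' j = 1 \<or> A' j = -1) \<and> (A' i = 2 \<or> A' i = -2)"
      using u by (elim disjE) simp_all
    then have "A' i * A' i + A' j * A' j = 5" by auto
    then show False using AA' rest_neq_7[OF ij, of A'] by simp
  next
    case False
    have sD: "s * dot D D \<ge> s * 1" using s False nonneg by (intro mult_left_mono) auto
    have mB: "m * dot B B \<ge> m * 1" using m B0 nonneg by (intro mult_left_mono) auto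
    have nC: "n * dot C C \<ge> n * 1" using m n DC0 nonneg by (intro mult_left_mono) auto
    have "dot B B \<ge> 2 \<and> dot C C \<ge> 2 \<or> dot B B \<ge> 5 \<and> dot C C = 1 \<or> dot B B = 1 \<and> dot C C \<ge> 5
        \<or> dot B B = 1 \<and> dot C C = 1"
      using B0 DC0 nonneg cong by presburger
    then consider "dot B B \<ge> 2" "dot C C \<ge> 2" | "dot B B \<ge> 5" "dot C C = 1"
      | "dot B B = 1" "dot C C \<ge> 5" | "dot B B = 1" "dot C C = 1" by blast
    then show False
    proof cases
      case 1
      then have "m * dot B B \<ge> m * 2" "n * dot C C \<ge> n * 2"
        using m n by (auto intro!: mult_left_mono)
      then show False using e0 sD nonneg s by linarith
    next
      case 2
      then have "m * dot B B \<ge> m * 5" using m by (intro mult_left_mono) auto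
      \<comment> \<open>A nonzero \<open>D\<close> costs more than the \<open>n\<close> that is
        saved: \<open>s - n \<ge> 9 * (b - c)\<close>. Together with
        \<open>3 * m \<ge> 15 * c\<close> the excess is at least \<open>9 * b + 6 * c\<close>, which
        is above 48.\<close>
      moreover have "9 * (b - c) \<le> a * (b - c)" using a b c by (intro mult_right_mono) auto
      then have "9 * b - 9 * c \<le> s - n" by (simp add: mns algebra_simps)
      moreover have "m \<ge> 5 * c" unfolding mns using b c0 by (intro mult_right_mono) auto
      moreover have "n * dot C C = n" using 2 by simp
      ultimately show False using e0 sD nonneg b c0 by linarith
    next
      case 3
      then have "n * dot C C \<ge> n * 5" using m n by (intro mult_left_mono) auto
      then show False using e0 sD mB nonneg s n m by linarith
    next
      case 4
      from 4 parBC obtain i where i: "i < 5" and u: "B i = 1 \<or> B i = -1" "C i = 1 \<or> C i = -1"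
        and Bl: "\<forall>l<5. l \<noteq> i \<longrightarrow> B l = 0" and Cl: "\<forall>l<5. l \<noteq> i \<longrightarrow> C l = 0"
        by (rule dot_self_eq_1_common_supportE) blast
      have f1: "A i * B i + a * (C i * D i) = -2" using e1 dot_single[OF i Bl] dot_single[OF i Cl] by simp
      have f2: "A i * C i + b * (B i * D i) = 6" using e2 dot_single[OF i Bl] dot_single[OF i Cl] by simp
      have BBi: "B i * B i = 1" using u by auto
      \<comment> \<open>\<open>B\<close> and \<open>C\<close> are supported at one position and
        \<open>e\<close> is their relative sign. Normalising by the sign of \<open>B i\<close>
        leaves two linear equations; eliminating \<open>x\<close> gives
        \<open>(a - b) * d = -8\<close> or \<open>-4\<close>, so only differences from 4 to 8
        survive.\<close>
      define e where "e = B i * C i"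
      have e: "e = 1 \<or> e = -1" using u by (auto simp: e_def)
      have Ci: "C i = e * B i" using BBi by (simp add: e_def)
      define d where "d = B i * D i"
      define x where "x = A i * B i"
      have g1: "x + a * (e * d) = -2" using f1 by (simp add: x_def d_def Ci algebra_simps)
      have g2: "e * x + b * d = 6" using f2 by (simp add: x_def d_def Ci algebra_simps)
      have "A i * A i = x * x" using BBi by (simp add: x_def algebra_simps)
      then have xA: "x * x \<le> dot A A" using dot_remove[OF i, of A A] by (simp add: sum_nonneg)
      have e0': "dot A A + s * dot D D = 48 + m + n" using e0 4 by simp
      have "b * c \<le> b * (b - 1)" "a * c \<le> a * (b - 1)" using a b c by (auto intro!: mult_left_mono)
      then have bound: "x * x + a * b \<le> 48 + b * (b - 1) + a * (b - 1)"
        using e0' sD xA mns by linarith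
      have dab: "(a - b) * d = (if e = 1 then -8 else -4)" using g1 g2 e by (auto simp: algebra_simps)
      have d0: "d \<le> -1"
      proof (rule ccontr)
        assume "\<not> d \<le> -1"
        then have "(a - b) * d \<ge> 0" using a by simp
        then show False using dab by (auto split: if_splits)
      qed
      have "a * (- d) \<ge> a * 1" using a b d0 by (intro mult_left_mono) auto
      then have "\<bar>x\<bar> \<ge> a - 2" using g1 e by auto
      then have "\<bar>x\<bar> * \<bar>x\<bar> \<ge> (a - 2) * (a - 2)" using a b by (intro mult_mono) auto
      then have x2: "x * x \<ge> (a - 2) * (a - 2)" by simp
      have "a - b \<le> 8"
      proof -
        have "(a - b) * (- d) \<ge> (a - b) * 1" using a d0 by (intro mult_left_mono) auto
        then show ?thesis using dab by (auto split: if_splits)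
      qed
      then have "a = b + 4 \<or> a = b + 5 \<or> a = b + 6 \<or> a = b + 7 \<or> a = b + 8" using a by linarith
      then show False
      proof (elim disjE)
        \<comment> \<open>Only for this difference is \<open>\<bar>x\<bar> \<ge> a - 2\<close> too
          weak, namely if \<open>b\<close> is 5 or 6. The exact value of \<open>d\<close> improves
          it to \<open>b + 6\<close>.\<close>
        assume ab: "a = b + 4"
        have "\<bar>x\<bar> \<ge> b + 6"
        proof (cases "e = 1")
          case True
          then have "d = -2" using dab ab by simp
          then show ?thesis using g1 ab b True by simp
        next
          case False
          then have "d = -1" "e = -1" using dab ab e by auto
          then show ?thesis using g1 ab by simp
        qed
        then have "\<bar>x\<bar> * \<bar>x\<bar> \<ge> (b + 6) * (b + 6)" using b by (intro mult_mono) auto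
        then have "x * x \<ge> (b + 6) * (b + 6)" by simp
        then show False using bound b ab by (simp add: algebra_simps)
      qed (use x2 bound b in \<open>simp_all add: algebra_simps\<close>)
    qed
  qed
qed

section \<open>Type A with all coordinates even\<close>

text \<open>Once \<open>D = 0\<close>, integrality says that \<open>A\<close> is congruent to
  \<open>B + C\<close> modulo 2. As \<open>B\<close> and \<open>C\<close> are orthogonal and their
  products with \<open>A\<close> are odd, both have odd norm, so a norm other than 1 is at least 3
  and too expensive. The constant is \<open>29 + t * t = 28 + t * t + 1\<close>.\<close>

lemma no_solution_type_A_even:
  fixes a b c p q r t :: int
  assumes t: "odd t" "t > 0" and a: "a > t" and b: "b > 1" and c: "c > 0"
    and p: "2 * p > 29 + t * t" and q: "2 * q > 29 + t * t" and r: "r > 29 + t * t"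
    and par: "\<And>i. i < 5 \<Longrightarrow> even (A i + B i + C i + D i)"
    and e0: "dot A A + p * dot B B + q * dot C C + r * dot D D = 29 + t * t + p + q"
    and e1: "dot A B + a * dot C D = t"
    and e2: "dot A C + b * dot B D = 1"
    and e3: "dot A D + c * dot B C = 0"
  shows False
proof -
  note nonneg = dot_self_nonneg[of A] dot_self_nonneg[of B] dot_self_nonneg[of C] dot_self_nonneg[of D]
  have pos: "p > 0" "q > 0" "r > 0" using p q r zero_le_square[of t] by linarith+
  have B0: "dot B B \<noteq> 0"
  proof
    assume z: "dot B B = 0"
    then have "a * dot C D = t" using e1 dot_eq_0_right[OF z] by simp
    then have "a dvd t" by (metis dvd_triv_left)
    then show False using a t zdvd_not_zless by blast
  qed
  have C0: "dot C C \<noteq> 0"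
  proof
    assume z: "dot C C = 0"
    then have "b * dot B D = 1" using e2 dot_eq_0_right[OF z] by simp
    then have "b dvd 1" by (metis dvd_triv_left)
    then show False using b by (simp add: zdvd_not_zless)
  qed
  have pB: "p * dot B B \<ge> p * 1" using pos B0 nonneg by (intro mult_left_mono) auto
  have qC: "q * dot C C \<ge> q * 1" using pos C0 nonneg by (intro mult_left_mono) auto
  have D0: "dot D D = 0"
  proof (rule ccontr)
    assume "dot D D \<noteq> 0"
    then have "r * dot D D \<ge> r * 1" using pos nonneg by (intro mult_left_mono) auto
    then show False using e0 pB qC nonneg r by linarith
  qed
  have AB: "dot A B = t" and AC: "dot A C = 1" and BC: "dot B C = 0"
    using e1 e2 e3 c dot_eq_0_right[OF D0] by auto
  have e0': "dot A A + p * dot B B + q * dot C C = 29 + t * t + p + q" using e0 D0 by simp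
  have sums: "dot X (\<lambda>i. B i + C i) = dot X B + dot X C" for X
    by (simp add: dot_def distrib_left sum.distrib)
  have parA: "even (A i + (B i + C i))" if "i < 5" for i
    using par[OF that] dot_self_eq_0D[OF D0 that] by (simp add: add.assoc)
  have "even (dot X A + dot X (\<lambda>i. B i + C i))" for X
    using parA by (intro dot_cong_parity)
  then have "even (dot X A + dot X B + dot X C)" for X by (simp add: sums add.assoc)
  from this[of B] this[of C] have odd: "odd (dot B B)" "odd (dot C C)"
    using AB AC BC t dot_commute[of B A] dot_commute[of C A] dot_commute[of C B] by simp_all
  have BB: "dot B B = 1"
  proof (rule ccontr)
    assume "dot B B \<noteq> 1"
    then have "dot B B \<ge> 3" using odd B0 nonneg by presburger
    then have "p * dot B B \<ge> p * 3" using pos by (intro mult_left_mono) auto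
    then show False using e0' qC nonneg p by linarith
  qed
  have CC: "dot C C = 1"
  proof (rule ccontr)
    assume "dot C C \<noteq> 1"
    then have "dot C C \<ge> 3" using odd C0 nonneg by presburger
    then have "q * dot C C \<ge> q * 3" using pos by (intro mult_left_mono) auto
    then show False using e0' pB nonneg q by linarith
  qed
  from BB obtain i where i: "i < 5" "B i = 1 \<or> B i = -1" "\<forall>l<5. l \<noteq> i \<longrightarrow> B l = 0"
    by (rule dot_self_eq_1E) blast
  from CC obtain j where j: "j < 5" "C j = 1 \<or> C j = -1" "\<forall>l<5. l \<noteq> j \<longrightarrow> C l = 0"
    by (rule dot_self_eq_1E) blast
  have "B i * C i = 0" using dot_single(1)[OF i(1,3)] BC by simp
  then have "i \<noteq> j" using i(2) j(2) by auto
  have "A i * B i = t" using dot_single(2)[OF i(1,3)] AB by simp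
  then have Ai: "A i = t \<or> A i = -t" using i(2) by auto
  have "A j * C j = 1" using dot_single(2)[OF j(1,3)] AC by simp
  then have "A j = 1 \<or> A j = -1" using j(2) by auto
  with Ai have "A i * A i + A j * A j = t * t + 1" by auto
  moreover have "\<forall>l<5. l \<noteq> i \<longrightarrow> l \<noteq> j \<longrightarrow> even (A l)"
  proof (intro allI impI)
    fix l :: nat assume "l < 5" "l \<noteq> i" "l \<noteq> j"
    then show "even (A l)" using parA[of l] i(3) j(3) by simp
  qed
  ultimately show False using rest_neq_28[OF i(1) j(1) \<open>i \<noteq> j\<close>, of A] e0' BB CC by auto
qed

section \<open>Type A: the number of summands with odd coordinates\<close>

text \<open>An odd entry is nonzero, so the number of odd positions is a lower bound for the
  norm.\<close>

lemma dot_self_ge_indicator: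
  assumes "\<And>i. i < 5 \<Longrightarrow> E i \<in> {0, 1}" "\<And>i. i < 5 \<Longrightarrow> even (X i + E i)"
  shows "dot E E \<le> dot X X"
  unfolding dot_def
proof (rule sum_mono)
  fix i :: nat assume "i \<in> {..<5}"
  then have "i < 5" by simp
  show "E i * E i \<le> X i * X i"
  proof (cases "E i = 0")
    case False
    then have "E i = 1" using assms(1)[OF \<open>i < 5\<close>] by simp
    then have "X i \<noteq> 0" using assms(2)[OF \<open>i < 5\<close>] by auto
    then have "X i * X i > 0" by (simp add: zero_less_mult_iff) linarith
    then show ?thesis using \<open>E i = 1\<close> by simp
  qed simp
qed

lemma odd_square_mod_8: "8 dvd x * x - 1" if "odd x" for x :: int
proof -
  from that obtain k where k: "x = 2 * k + 1" by (rule oddE)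
  have "even (k * (k + 1))" by simp
  then obtain l where "k * (k + 1) = 2 * l" by (elim evenE)
  then have "x * x - 1 = 8 * l" using k by (simp add: algebra_simps)
  then show ?thesis by simp
qed

lemma quaternary_form_mod_8_odd:
  fixes p q r :: int
  assumes "odd A" "odd B" "odd C" "odd D"
  shows "8 dvd (A * A + p * (B * B) + q * (C * C) + r * (D * D)) - (1 + p + q + r)"
proof -
  have "(A * A + p * (B * B) + q * (C * C) + r * (D * D)) - (1 + p + q + r) =
      (A * A - 1) + p * (B * B - 1) + q * (C * C - 1) + r * (D * D - 1)"
    by (simp add: algebra_simps)
  moreover have "8 dvd (A * A - 1) + p * (B * B - 1) + q * (C * C - 1) + r * (D * D - 1)"
    using assms by (intro dvd_add dvd_mult odd_square_mod_8)
  ultimately show ?thesis by (simp only:)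
qed

text \<open>Halving the coordinates splits off a factor 4. With odd coefficients, the halved form
  has the parity of the sum of the halved coordinates, and that sum is even.\<close>

lemma quaternary_form_mod_8_even:
  fixes p q r :: int
  assumes "even A" "even B" "even C" "even D" "4 dvd A + B + C + D"
    and "odd p" "odd q" "odd r"
  shows "8 dvd A * A + p * (B * B) + q * (C * C) + r * (D * D)"
proof -
  obtain A' B' C' D' where d: "A = 2 * A'" "B = 2 * B'" "C = 2 * C'" "D = 2 * D'"
    using assms(1-4) by (metis evenE)
  have "even (A' + B' + C' + D')" using assms(5) unfolding d by presburger
  then have "even (A' * A' + p * (B' * B') + q * (C' * C') + r * (D' * D'))"
    using assms(6-8) by simp
  then obtain k where k: "A' * A' + p * (B' * B') + q * (C' * C') + r * (D' * D') = 2 * k" by (rule evenE)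
  have "A * A + p * (B * B) + q * (C * C) + r * (D * D) =
      4 * (A' * A' + p * (B' * B') + q * (C' * C') + r * (D' * D'))"
    unfolding d by (simp add: algebra_simps)
  then show ?thesis unfolding k by simp
qed

text \<open>Since \<open>1 + p + q + r \<equiv> (a + c)(b + c) \<equiv> 4\<close> modulo 8, the number of indices with odd
  coordinates is even; by size it is at most 2, and 2 is excluded by the geometry of vectors of
  norm 2.\<close>

lemma type_A_solution_even:
  fixes a b c p q r :: int
  assumes c: "c \<ge> 3" and b: "b \<ge> c + 4" and a: "a \<ge> b + 4"
    and abc: "odd c" "4 dvd b - c" "4 dvd a - c"
    and pqr: "p = b * c" "q = a * c" "r = a * b"
    and parB: "\<And>i. i < 5 \<Longrightarrow> even (A i + B i)"
    and parC: "\<And>i. i < 5 \<Longrightarrow> even (A i + C i)"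
    and parD: "\<And>i. i < 5 \<Longrightarrow> even (A i + D i)"
    and par: "\<And>i. i < 5 \<Longrightarrow> even (A i) \<Longrightarrow> 4 dvd A i + B i + C i + D i"
    and e0: "dot A A + p * dot B B + q * dot C C + r * dot D D = 152 + 4 * p + 4 * q"
    and e1: "dot A B + a * dot C D = 12"
    and e2: "dot A C + b * dot B D = 4"
    and e3: "dot A D + c * dot B C = 0"
    and "i < 5"
  shows "even (A i)"
proof -
  note nonneg = dot_self_nonneg[of A] dot_self_nonneg[of B] dot_self_nonneg[of C] dot_self_nonneg[of D]
  \<comment> \<open>All four coordinates of a summand have the same parity, so one indicator vector
    serves for all of them and \<open>k\<close> counts the odd summands.\<close>
  define E where "E l = A l mod 2" for l
  define k where "k = dot E E"
  have E01: "E l \<in> {0, 1}" for l unfolding E_def by auto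
  have EA: "even (A l + E l)" for l unfolding E_def by presburger
  have EX: "even (B l + E l)" "even (C l + E l)" "even (D l + E l)" if "l < 5" for l
    using EA[of l] parB[OF that] parC[OF that] parD[OF that] by presburger+
  have p: "p \<ge> 21" unfolding pqr using mult_mono[of 7 b 3 c] b c by simp
  have q: "q \<ge> p + 12"
  proof -
    have "(a - b) * c \<ge> 4 * 3" using a c by (intro mult_mono) auto
    then show ?thesis by (simp add: pqr algebra_simps)
  qed
  have r: "r \<ge> q + 4 * a"
  proof -
    have "a * (b - c) \<ge> a * 4" using a b c by (intro mult_left_mono) auto
    then show ?thesis by (simp add: pqr algebra_simps)
  qed
  have r77: "r \<ge> 77" unfolding pqr using mult_mono[of 11 a 7 b] a b c by simp
  have ge: "dot X X \<ge> k" if "\<And>l. l < 5 \<Longrightarrow> even (X l + E l)" for X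
    unfolding k_def using E01 that by (intro dot_self_ge_indicator) auto
  have cong: "4 dvd dot X X - k" if "\<And>l. l < 5 \<Longrightarrow> even (X l + E l)" for X
    unfolding k_def using that by (rule dot_self_cong_4)
  have Ak: "dot A A \<ge> k" and Bk: "dot B B \<ge> k" and Ck: "dot C C \<ge> k" and Dk: "dot D D \<ge> k"
    using ge EA EX by blast+
  have Bc: "4 dvd dot B B - k" and Cc: "4 dvd dot C C - k" and Dc: "4 dvd dot D D - k"
    using cong EX by blast+
  have k0: "k \<ge> 0" unfolding k_def by (rule dot_self_nonneg)
  have pk: "p * dot B B \<ge> p * k" and qk: "q * dot C C \<ge> q * k" and rk: "r * dot D D \<ge> r * k"
    using Bk Ck Dk p q r77 by (auto intro!: mult_left_mono)
  \<comment> \<open>Three odd summands require \<open>3 * r - p - q\<close> to fit into 152, but it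
    is at least \<open>77 + 56 + 44\<close>.\<close>
  have k3: "k < 3"
  proof (rule ccontr)
    assume "\<not> k < 3"
    then have "p * k \<ge> p * 3" "q * k \<ge> q * 3" "r * k \<ge> r * 3" 
      using p q r77 by (auto intro!: mult_left_mono)
    moreover have "b * (a - c) \<ge> 7 * 8" using a b c by (intro mult_mono) auto
    then have "r - p \<ge> 56" by (simp add: pqr algebra_simps)
    ultimately show False using e0 pk qk rk Ak \<open>\<not> k < 3\<close> r r77 a b c by linarith
  qed
  have "odd a" "odd b" using abc by presburger+
  then have odds: "odd p" "odd q" "odd r" unfolding pqr using abc(1) by simp_all
  have mod8: "8 dvd (1 + p + q + r) - 4"
  proof -
    obtain v where v: "b - c = 4 * v" using abc(2) by (elim dvdE)
    obtain w where w: "a - c = 4 * w" using abc(3) by (elim dvdE)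
    have "odd ((c + 2 * v) * (c + 2 * w))" using abc(1) by simp
    then obtain z where z: "(c + 2 * v) * (c + 2 * w) = 2 * z + 1" by (rule oddE)
    have b': "b = c + 4 * v" and a': "a = c + 4 * w" using v w by auto
    have "(1 + p + q + r) - 4 = 4 * ((c + 2 * v) * (c + 2 * w)) - (c * c - 1) - 4"
      unfolding pqr a' b' by (simp add: algebra_simps)
    then have "(1 + p + q + r) - 4 = 8 * z - (c * c - 1)" unfolding z by simp
    then show ?thesis using odd_square_mod_8[OF abc(1)] by (simp only: dvd_diff dvd_triv_left)
  qed
  have "8 dvd (A l * A l + p * (B l * B l) + q * (C l * C l) + r * (D l * D l)) - 4 * (E l * E l)"
    if l: "l < 5" for l
  proof (cases "even (A l)")
    case True
    then have "E l = 0" by (simp add: E_def)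
    then show ?thesis using quaternary_form_mod_8_even[OF True _ _ _ par[OF l True] odds]
        True parB[OF l] parC[OF l] parD[OF l] by simp
  next
    case False
    then have "E l = 1" by (simp add: E_def odd_iff_mod_2_eq_one)
    have "8 dvd (A l * A l + p * (B l * B l) + q * (C l * C l) + r * (D l * D l)) - (1 + p + q + r)"
      using False parB[OF l] parC[OF l] parD[OF l] by (intro quaternary_form_mod_8_odd) auto
    from dvd_add[OF this mod8] have
      "8 dvd (A l * A l + p * (B l * B l) + q * (C l * C l) + r * (D l * D l)) - 4"
      by (simp add: algebra_simps)
    with \<open>E l = 1\<close> show ?thesis by simp
  qed
  then have "8 dvd (\<Sum>l<5. (A l * A l + p * (B l * B l) + q * (C l * C l) + r * (D l * D l)) - 4 * (E l * E l))"
    by (intro dvd_sum) auto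
  then have "8 dvd (dot A A + p * dot B B + q * dot C C + r * dot D D) - 4 * k"
    by (simp add: k_def dot_def sum.distrib sum_subtractf sum_distrib_left)
  \<comment> \<open>Hence \<open>4 * p + 4 * q\<close> vanishes modulo 8, as does 152, and only
    \<open>4 * k\<close> is left.\<close>
  moreover have "4 dvd p + q - 2"
  proof -
    obtain v where v: "b - c = 4 * v" using abc(2) by (elim dvdE)
    obtain w where w: "a - c = 4 * w" using abc(3) by (elim dvdE)
    have "p + q - 2 = 4 * (v * c + w * c) + 2 * (c * c - 1)"
    proof -
      have "b = c + 4 * v" "a = c + 4 * w" using v w by auto
      then show ?thesis by (simp add: pqr algebra_simps)
    qed
    moreover have "4 dvd c * c - 1" using odd_square_mod_8[OF abc(1)] dvd_trans[of 4 8 "c * c - 1"] by simp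
    ultimately show ?thesis by (simp only: dvd_add dvd_triv_left dvd_mult)
  qed
  ultimately have "8 dvd 152 + 4 * p + 4 * q - 4 * k" "4 dvd p + q - 2" unfolding e0 .
  then have "even k" by presburger
  then have "k = 0 \<or> k = 2" using k0 k3 by presburger
  then show ?thesis
  proof
    assume "k = 0"
    then have "E i = 0" using \<open>i < 5\<close> dot_self_eq_0D unfolding k_def by blast
    then show ?thesis using EA[of i] by simp
  next
    assume k: "k = 2"
    have CC: "dot C C = 2"
    proof (rule ccontr)
      assume "dot C C \<noteq> 2"
      then have "dot C C \<ge> 6" using Ck Cc k by presburger
      then have "q * dot C C \<ge> q * 6" using p q by (intro mult_left_mono) auto
      then show False using e0 pk[unfolded k] rk[unfolded k] nonneg q r77 by linarith
    qed
    have DD: "dot D D = 2"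
    proof (rule ccontr)
      assume "dot D D \<noteq> 2"
      then have "dot D D \<ge> 6" using Dk Dc k by presburger
      then have "r * dot D D \<ge> r * 6" using r77 by (intro mult_left_mono) auto
      then show False using e0 pk[unfolded k] qk[unfolded k] nonneg q r a b c r77 by linarith
    qed
    have parCD: "even (C l + D l)" if "l < 5" for l using parC[OF that] parD[OF that] by presburger
    from CC DD parCD obtain i j where ij: "i < 5" "j < 5" "i \<noteq> j"
      and u: "C i = 1 \<or> C i = -1" "C j = 1 \<or> C j = -1" "D i = 1 \<or> D i = -1" "D j = 1 \<or> D j = -1"
      and Cl: "\<forall>l<5. l \<noteq> i \<longrightarrow> l \<noteq> j \<longrightarrow> C l = 0" and Dl: "\<forall>l<5. l \<noteq> i \<longrightarrow> l \<noteq> j \<longrightarrow> D l = 0"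
      by (rule dot_self_eq_2_common_supportE) blast
    note dotC = dot_pair[OF ij Cl] and dotD = dot_pair[OF ij Dl]
    \<comment> \<open>Two sign vectors on the same two positions are parallel or orthogonal.\<close>
    have "(C i = D i \<and> C j = D j \<or> C i = - D i \<and> C j = - D j) \<or> C i * D i + C j * D j = 0"
      using u by auto
    then show ?thesis
    proof
      assume "C i = D i \<and> C j = D j \<or> C i = - D i \<and> C j = - D j"
      then have "\<exists>e::int. (e = 1 \<or> e = -1) \<and> C i = e * D i \<and> C j = e * D j"
      proof
        assume "C i = D i \<and> C j = D j" then show ?thesis by (intro exI[of _ 1]) simp
      next
        assume "C i = - D i \<and> C j = - D j" then show ?thesis by (intro exI[of _ "-1"]) simp
      qed
      then obtain e :: int where e: "e = 1 \<or> e = -1" "C i = e * D i" "C j = e * D j" by blast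
      have "dot A C = e * dot A D" "dot B C = e * dot B D"
        by (simp_all add: dotC dotD e(2,3) algebra_simps)
      then have "dot A C = - c * dot B D" using e(1) e3 by auto
      \<comment> \<open>For parallel \<open>C\<close> and \<open>D\<close> the equations
        \<open>e2\<close> and \<open>e3\<close> combine. By size only \<open>b = c + 4\<close> with
        \<open>dot B D = 1\<close> could remain, and parity excludes it.\<close>
      then have bc4: "(b - c) * dot B D = 4" using e2 by (simp add: algebra_simps)
      have "odd (B i)" "odd (B j)" using EX(1,3)[OF ij(1)] EX(1,3)[OF ij(2)] u by auto
      then have "even (dot B D)" using u by (auto simp: dotD)
      then obtain d where "dot B D = 2 * d" by (elim evenE)
      then have "(b - c) * d = 2" using bc4 by (simp add: mult.commute)
      then have "b - c dvd 2" by (metis dvd_triv_left)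
      then show ?thesis using b zdvd_imp_le by fastforce
    next
      assume perp: "C i * D i + C j * D j = 0"
      then have CD: "dot C D = 0" by (simp add: dotC)
      then have AB: "dot A B = 12" using e1 by simp
      have BB: "dot B B = 2"
      proof (rule ccontr)
        assume "dot B B \<noteq> 2"
        then have ge6: "dot B B \<ge> 6" using Bk Bc k by presburger
        \<comment> \<open>This splits off from \<open>p * dot B B\<close> the part
          \<open>4 * dot B B\<close> that the estimate of \<open>dot A B\<close> consumes.\<close>
        have "(p - 4) * (dot B B - 6) \<ge> 0" using p ge6 by simp
        then have "p * dot B B \<ge> 6 * p + 4 * dot B B - 24" by (simp add: algebra_simps)
        moreover have "q * dot C C = 2 * q" "r * dot D D = 2 * r" using CC DD by auto
        ultimately show False using e0 dot_self_ge_4_mult[of A B] AB p r a b c by linarith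
      qed
      have parBC: "even (B l + C l)" if "l < 5" for l using parB[OF that] parC[OF that] by presburger
      have Bl: "\<forall>l<5. l \<noteq> i \<longrightarrow> l \<noteq> j \<longrightarrow> B l = 0" and uB: "B i = 1 \<or> B i = -1" "B j = 1 \<or> B j = -1"
      proof -
        from BB CC parBC obtain i' j' where ij': "i' < 5" "j' < 5" "i' \<noteq> j'"
          and v: "B i' = 1 \<or> B i' = -1" "B j' = 1 \<or> B j' = -1" "C i' = 1 \<or> C i' = -1" "C j' = 1 \<or> C j' = -1"
          and Bl': "\<forall>l<5. l \<noteq> i' \<longrightarrow> l \<noteq> j' \<longrightarrow> B l = 0"
          by (rule dot_self_eq_2_common_supportE) blast
        have "C i' \<noteq> 0" "C j' \<noteq> 0" using v by auto
        then have "i' = i \<or> i' = j" "j' = i \<or> j' = j" using Cl ij' by blast+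
        then have "i' = i \<and> j' = j \<or> i' = j \<and> j' = i" using ij'(3) by auto
        then show "\<forall>l<5. l \<noteq> i \<longrightarrow> l \<noteq> j \<longrightarrow> B l = 0" "B i = 1 \<or> B i = -1" "B j = 1 \<or> B j = -1"
          using v Bl' by blast+
      qed
      have "A i * B i + A j * B j = 12" using AB dot_pair(2)[OF ij Bl] by simp
      moreover have "A i * C i + A j * C j + b * (B i * D i + B j * D j) = 4" using e2 by (simp add: dotC dotD)
      moreover have "A i * D i + A j * D j + c * (B i * C i + B j * C j) = 0" using e3 by (simp add: dotC dotD)
      moreover have "(B i = C i \<and> B j = C j \<or> B i = - C i \<and> B j = - C j) \<or>
          (B i = D i \<and> B j = D j \<or> B i = - D i \<and> B j = - D j)"
        using uB u perp by (elim disjE) simp_all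
      moreover have "C j * D j = - (C i * D i)" "D j * C j = - (D i * C i)"
        using perp by (simp_all add: mult.commute)
      \<comment> \<open>It is decisive that 12 differs from the 4 in \<open>e2\<close>. If both
        values were 4, as for \<open>t = 1\<close>, then \<open>B = C\<close> would be compatible
        with \<open>e1\<close> and \<open>e2\<close>.\<close>
      ultimately have False by (elim disjE conjE) simp_all
      then show ?thesis ..
    qed
  qed
qed

section \<open>Integers of a biquadratic field\<close>

lemma sqrt_squarefree_irrational:
  fixes n :: int
  assumes "squarefree n" "n > 1"
  shows "sqrt (of_int n) \<notin> \<rat>"
proof
  assume "sqrt (of_int n) \<in> \<rat>"
  moreover have "algebraic_int (sqrt (of_int n))" by (intro algebraic_int_sqrt int_imp_algebraic_int) simp
  ultimately have "sqrt (real_of_int n) \<in> \<int>" by (intro rational_algebraic_int_is_int)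
  then obtain k where "sqrt (real_of_int n) = of_int k" by (elim Ints_cases)
  then have "real_of_int n = of_int (k ^ 2)" using assms(2) by (metis of_int_power real_sqrt_pow2 of_int_0_le_iff less_imp_le zero_less_one less_trans)
  then have n: "n = k ^ 2" by linarith
  then have "k dvd 1" by (intro squarefreeD[OF assms(1)]) simp
  then have "\<bar>k\<bar> = 1" by simp
  then have "k ^ 2 = 1" by (metis power2_abs one_power2)
  then show False using n assms(2) by simp
qed

lemma rational_square_eq_multD:
  fixes n :: int and u w :: real
  assumes "sqrt (of_int n) \<notin> \<rat>" "n > 0" "u \<in> \<rat>" "w \<in> \<rat>" "u\<^sup>2 = of_int n * w\<^sup>2"
  shows "w = 0 \<and> u = 0"
proof -
  have "w = 0"
  proof (rule ccontr)
    assume w: "w \<noteq> 0"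
    then have "(u / w)\<^sup>2 = of_int n" using assms(5) by (simp add: power_divide)
    then have "sqrt (of_int n) = \<bar>u / w\<bar>" by (metis real_sqrt_abs)
    then show False using assms(1,3,4) by (metis Rats_abs_iff Rats_divide)
  qed
  then show ?thesis using assms(5) by simp
qed

lemma squarefree_mult_square_IntsD:
  fixes n :: int and t :: real
  assumes "squarefree n" "t \<in> \<rat>" "of_int n * t\<^sup>2 \<in> \<int>"
  shows "t \<in> \<int>"
proof -
  obtain x y where xy: "y > 0" "coprime x y" "t = of_int x / of_int y"
    using assms(2) by (auto elim: Rats_cases')
  obtain m where "of_int n * t\<^sup>2 = of_int m" using assms(3) by (elim Ints_cases)
  then have "of_int n * (of_int x)\<^sup>2 = (of_int m * (of_int y)\<^sup>2 :: real)"
    using xy by (simp add: power_divide field_simps)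
  then have "real_of_int (n * x\<^sup>2) = of_int (m * y\<^sup>2)" by simp
  then have "n * x\<^sup>2 = m * y\<^sup>2" by linarith
  then have "y\<^sup>2 dvd n * x\<^sup>2" by simp
  moreover have "coprime (y\<^sup>2) (x\<^sup>2)" using xy(2) by (simp add: coprime_commute)
  ultimately have "y\<^sup>2 dvd n" by (simp add: coprime_dvd_mult_left_iff)
  then have "y dvd 1" using assms(1) squarefreeD by blast
  then have "y = 1" using xy(1) by simp
  then show ?thesis using xy(3) by simp
qed

text \<open>This form is symmetric in the three quadratic subfields. Square-freeness of the products
  also encodes that \<open>a\<close>, \<open>b\<close>, \<open>c\<close> are square-free and
  pairwise coprime; \<open>gt1\<close> says that no two of them are 1.\<close>

locale biquadratic =
  fixes a b c :: int
  assumes pos: "a > 0" "b > 0" "c > 0"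
    and sqfree: "squarefree (b * c)" "squarefree (a * c)" "squarefree (a * b)"
    and gt1: "b * c > 1" "a * c > 1" "a * b > 1"
begin

definition P :: real where "P = sqrt (of_int (b * c))"
definition Q :: real where "Q = sqrt (of_int (a * c))"
definition R :: real where "R = sqrt (of_int (a * b))"

lemma mults:
  "P * P = of_int (b * c)" "Q * Q = of_int (a * c)" "R * R = of_int (a * b)"
  "P * Q = of_int c * R" "P * R = of_int b * Q" "Q * R = of_int a * P"
proof -
  show "P * P = of_int (b * c)" "Q * Q = of_int (a * c)" "R * R = of_int (a * b)"
    using pos by (simp_all add: P_def Q_def R_def)
  have s: "sqrt (of_int x) * sqrt (of_int x) = of_int x" if "x > 0" for x :: int using that by simp
  have "sqrt (of_int x) * sqrt (of_int z) * (sqrt (of_int y) * sqrt (of_int z)) =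
      of_int z * (sqrt (of_int x) * sqrt (of_int y))" if "z > 0" for x y z :: int
    using s[OF that] by (simp add: algebra_simps)
  from this[OF pos(3), of b a] this[OF pos(2), of c a] this[OF pos(1), of c b]
  show "P * Q = of_int c * R" "P * R = of_int b * Q" "Q * R = of_int a * P"
    by (simp_all add: P_def Q_def R_def real_sqrt_mult mult_ac)
qed

lemma irrat: "P \<notin> \<rat>" "Q \<notin> \<rat>" "R \<notin> \<rat>"
  unfolding P_def Q_def R_def by (intro sqrt_squarefree_irrational sqfree gt1)+

definition quad :: "real \<Rightarrow> real \<Rightarrow> real \<Rightarrow> real \<Rightarrow> real" where
  "quad u v w z = u + v * P + w * Q + z * R"

lemma quad_add: "quad u v w z + quad u' v' w' z' = quad (u + u') (v + v') (w + w') (z + z')"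
  by (simp add: quad_def algebra_simps)

lemma quad_scale: "x * quad u v w z = quad (x * u) (x * v) (x * w) (x * z)"
  by (simp add: quad_def algebra_simps)

lemma quad_mult:
  "quad u v w z * quad u' v' w' z' =
    quad (u * u' + of_int (b * c) * (v * v') + of_int (a * c) * (w * w') + of_int (a * b) * (z * z'))
      (u * v' + v * u' + of_int a * (w * z' + z * w'))
      (u * w' + w * u' + of_int b * (v * z' + z * v'))
      (u * z' + z * u' + of_int c * (v * w' + w * v'))"
proof -
  have "quad u v w z * quad u' v' w' z' = u * u' + (P * P) * (v * v') + (Q * Q) * (w * w') + (R * R) * (z * z')
      + (u * v' + v * u') * P + (Q * R) * (w * z' + z * w')
      + (u * w' + w * u') * Q + (P * R) * (v * z' + z * v')
      + (u * z' + z * u') * R + (P * Q) * (v * w' + w * v')"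
    by (simp add: quad_def algebra_simps)
  then show ?thesis unfolding mults by (simp add: quad_def algebra_simps)
qed

text \<open>With \<open>t = z / c\<close> the relation reads
  \<open>u + v * P = - (w + t * P) * Q\<close>. Squaring and comparing rational parts and
  coefficients of \<open>P\<close> shows that the norms \<open>u^2 - p * v^2\<close> and
  \<open>q * (w^2 - p * t^2)\<close> agree up to sign. The two signs would make the square root of
  \<open>a * c\<close> or of \<open>a * b\<close> rational unless everything vanishes.\<close>

lemma quad_eq_0D:
  assumes rat: "u \<in> \<rat>" "v \<in> \<rat>" "w \<in> \<rat>" "z \<in> \<rat>" and "quad u v w z = 0"
  shows "u = 0 \<and> v = 0 \<and> w = 0 \<and> z = 0"
proof -
  define t where "t = z / of_int c"
  define p q r :: real where "p = of_int (b * c)" and "q = of_int (a * c)" and "r = of_int (a * b)"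
  have tr: "t \<in> \<rat>" using rat by (simp add: t_def)
  have z: "z = of_int c * t" using pos by (simp add: t_def)
  have "z * R = t * (P * Q)" by (simp add: z mults)
  then have "u + v * P = - (w + t * P) * Q" using assms(5) by (simp add: quad_def algebra_simps)
  then have "(u + v * P) * (u + v * P) = (- (w + t * P) * Q) * (- (w + t * P) * Q)" by (simp only:)
  also have "\<dots> = (w + t * P) * (w + t * P) * (Q * Q)" by (simp add: algebra_simps)
  finally have "(u + v * P) * (u + v * P) = (w + t * P) * (w + t * P) * (Q * Q)" .
  moreover have "(u + v * P) * (u + v * P) = u\<^sup>2 + v\<^sup>2 * (P * P) + 2 * u * v * P"
    "(w + t * P) * (w + t * P) = w\<^sup>2 + t\<^sup>2 * (P * P) + 2 * w * t * P"
    by (simp_all add: power2_eq_square algebra_simps)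
  ultimately have eq: "u\<^sup>2 + v\<^sup>2 * p + 2 * u * v * P = (w\<^sup>2 + t\<^sup>2 * p + 2 * w * t * P) * q"
    unfolding mults p_def q_def by simp
  have pq: "p \<in> \<rat>" "q \<in> \<rat>" by (simp_all add: p_def q_def)
  have uv: "u * v = q * (w * t)"
  proof (rule ccontr)
    assume "u * v \<noteq> q * (w * t)"
    then have "P = (q * (w\<^sup>2 + t\<^sup>2 * p) - (u\<^sup>2 + v\<^sup>2 * p)) / (2 * (u * v - q * (w * t)))"
      using eq by (simp add: field_simps)
    moreover have "\<dots> \<in> \<rat>" using rat tr pq by (intro Rats_divide Rats_diff Rats_mult Rats_add Rats_power) auto
    ultimately show False using irrat(1) by simp
  qed
  have eq2: "u\<^sup>2 + p * v\<^sup>2 = q * (w\<^sup>2 + p * t\<^sup>2)"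
  proof -
    have "u\<^sup>2 + p * v\<^sup>2 + u * v * (2 * P) = q * (w\<^sup>2 + p * t\<^sup>2) + q * (w * t) * (2 * P)"
      using eq by (simp add: algebra_simps)
    then show ?thesis unfolding uv by simp
  qed
  have "(u\<^sup>2 - p * v\<^sup>2)\<^sup>2 = (u\<^sup>2 + p * v\<^sup>2)\<^sup>2 - 4 * p * (u * v)\<^sup>2" by (simp add: power2_eq_square algebra_simps)
  also have "\<dots> = (q * (w\<^sup>2 - p * t\<^sup>2))\<^sup>2" unfolding eq2 uv by (simp add: power2_eq_square algebra_simps)
  finally have "u\<^sup>2 - p * v\<^sup>2 = q * (w\<^sup>2 - p * t\<^sup>2) \<or> u\<^sup>2 - p * v\<^sup>2 = - (q * (w\<^sup>2 - p * t\<^sup>2))"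
    by (auto simp: power2_eq_iff)
  moreover have "q * (w\<^sup>2 - p * t\<^sup>2) = q * w\<^sup>2 - p * (q * t\<^sup>2)" "q * (w\<^sup>2 + p * t\<^sup>2) = q * w\<^sup>2 + p * (q * t\<^sup>2)"
    by (simp_all add: algebra_simps)
  ultimately consider "u\<^sup>2 = q * w\<^sup>2" "p * v\<^sup>2 = p * (q * t\<^sup>2)" | "u\<^sup>2 = p * (q * t\<^sup>2)" "p * v\<^sup>2 = q * w\<^sup>2"
    using eq2 by linarith
  then show ?thesis
  proof cases
    case 1
    then have "u\<^sup>2 = q * w\<^sup>2" "v\<^sup>2 = q * t\<^sup>2" using pos by (auto simp: p_def)
    then show ?thesis
      using rational_square_eq_multD[OF irrat(2)[unfolded Q_def] _ rat(1,3)]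
        rational_square_eq_multD[OF irrat(2)[unfolded Q_def] _ rat(2) tr] pos z
      unfolding q_def by simp
  next
    case 2
    then have "u\<^sup>2 = p * q * t\<^sup>2" by simp
    moreover have pqr: "p * q = r * (of_int c)\<^sup>2" by (simp add: p_def q_def r_def power2_eq_square)
    ultimately have "u\<^sup>2 = r * z\<^sup>2" by (simp add: z power_mult_distrib)
    moreover have "(p * v)\<^sup>2 = r * (of_int c * w)\<^sup>2"
    proof -
      have "(p * v)\<^sup>2 = p * (p * v\<^sup>2)" by (simp add: power2_eq_square)
      also have "\<dots> = p * q * w\<^sup>2" using 2(2) by simp
      finally show ?thesis unfolding pqr by (simp add: power_mult_distrib)
    qed
    moreover have "p * v \<in> \<rat>" "of_int c * w \<in> \<rat>" using pq rat by auto
    ultimately have "z = 0 \<and> u = 0" "of_int c * w = 0 \<and> p * v = 0"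
      using rational_square_eq_multD[OF irrat(3)[unfolded R_def] _ rat(1,4)]
        rational_square_eq_multD[OF irrat(3)[unfolded R_def], of "p * v" "of_int c * w"] pos
      unfolding r_def by simp_all
    then show ?thesis using pos gt1 by (auto simp: p_def)
  qed
qed

lemma quad_inject:
  assumes "u \<in> \<rat>" "v \<in> \<rat>" "w \<in> \<rat>" "z \<in> \<rat>" "u' \<in> \<rat>" "v' \<in> \<rat>" "w' \<in> \<rat>" "z' \<in> \<rat>"
    and "quad u v w z = quad u' v' w' z'"
  shows "u = u' \<and> v = v' \<and> w = w' \<and> z = z'"
proof -
  have "quad (u - u') (v - v') (w - w') (z - z') = 0" using assms(9) by (simp add: quad_def algebra_simps)
  from quad_eq_0D[OF _ _ _ _ this] assms show ?thesis by auto
qed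

definition span :: "real set" where
  "span = {quad u v w z | u v w z. u \<in> \<rat> \<and> v \<in> \<rat> \<and> w \<in> \<rat> \<and> z \<in> \<rat>}"

text \<open>An order of the field. It stands in for the ring of integers, whose basis depends on
  residues modulo 4.\<close>

definition lattice :: "real set" where
  "lattice = {quad u v w z | u v w z. u \<in> \<int> \<and> v \<in> \<int> \<and> w \<in> \<int> \<and> z \<in> \<int>}"

lemma spanI: "u \<in> \<rat> \<Longrightarrow> v \<in> \<rat> \<Longrightarrow> w \<in> \<rat> \<Longrightarrow> z \<in> \<rat> \<Longrightarrow> quad u v w z \<in> span"
  by (auto simp: span_def)

lemma latticeI: "u \<in> \<int> \<Longrightarrow> v \<in> \<int> \<Longrightarrow> w \<in> \<int> \<Longrightarrow> z \<in> \<int> \<Longrightarrow> quad u v w z \<in> lattice"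
  by (auto simp: lattice_def)

lemma spanE:
  assumes "x \<in> span"
  obtains u v w z where "u \<in> \<rat>" "v \<in> \<rat>" "w \<in> \<rat>" "z \<in> \<rat>" "x = quad u v w z"
  using assms by (auto simp: span_def)

lemma latticeE:
  assumes "x \<in> lattice"
  obtains u v w z where "u \<in> \<int>" "v \<in> \<int>" "w \<in> \<int>" "z \<in> \<int>" "x = quad u v w z"
  using assms by (auto simp: lattice_def)

lemma lattice_add: "x \<in> lattice \<Longrightarrow> y \<in> lattice \<Longrightarrow> x + y \<in> lattice"
  by (elim latticeE) (auto simp: quad_add intro!: latticeI)

lemma lattice_mult: "x \<in> lattice \<Longrightarrow> y \<in> lattice \<Longrightarrow> x * y \<in> lattice"
  by (elim latticeE) (simp only: quad_mult, intro latticeI Ints_add Ints_mult Ints_of_int)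

lemma span_mult: "x \<in> span \<Longrightarrow> y \<in> span \<Longrightarrow> x * y \<in> span"
  by (elim spanE) (simp only: quad_mult, intro spanI Rats_add Rats_mult Rats_of_int)

lemma Ints_subset_lattice: "x \<in> \<int> \<Longrightarrow> x \<in> lattice"
  using latticeI[of x 0 0 0] by (simp add: quad_def)

lemma Rats_subset_span: "x \<in> \<rat> \<Longrightarrow> x \<in> span"
  using spanI[of x 0 0 0] by (simp add: quad_def)

lemma lattice_sum: "(\<And>i. i \<in> I \<Longrightarrow> f i \<in> lattice) \<Longrightarrow> sum f I \<in> lattice"
  by (induction I rule: infinite_finite_induct) (auto intro: lattice_add Ints_subset_lattice)

lemma span_power: "x \<in> span \<Longrightarrow> x ^ k \<in> span"
  by (induction k) (auto intro: span_mult Rats_subset_span)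

text \<open>Powers with bounded denominators: the closure properties of algebraic integers in the field
  are immediate for this condition, which algebraic integers satisfy.\<close>

definition almost_integral :: "real \<Rightarrow> bool" where
  "almost_integral x \<longleftrightarrow> (\<exists>N::int. N > 0 \<and> (\<forall>k. of_int N * x ^ k \<in> lattice))"

lemma span_denominator:
  assumes "x \<in> span"
  shows "\<exists>N::int. N > 0 \<and> of_int N * x \<in> lattice"
proof -
  from assms obtain u v w z where *: "u \<in> \<rat>" "v \<in> \<rat>" "w \<in> \<rat>" "z \<in> \<rat>" "x = quad u v w z"
    by (rule spanE)
  have den: "\<exists>n::int. n > 0 \<and> of_int n * y \<in> \<int>" if y: "y \<in> \<rat>" for y :: real
  proof -
    obtain s t :: int where "t > 0" "coprime s t" "y = of_int s / of_int t" using y by (auto elim: Rats_cases')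
    then show ?thesis by (intro exI[of _ t]) auto
  qed
  obtain n1 n2 n3 n4 :: int where n: "n1 > 0" "n2 > 0" "n3 > 0" "n4 > 0"
    "of_int n1 * u \<in> \<int>" "of_int n2 * v \<in> \<int>" "of_int n3 * w \<in> \<int>" "of_int n4 * z \<in> \<int>"
    using den *(1-4) by metis
  let ?N = "n1 * n2 * n3 * n4"
  have "of_int ?N * x = quad (of_int (n2 * n3 * n4) * (of_int n1 * u)) (of_int (n1 * n3 * n4) * (of_int n2 * v))
      (of_int (n1 * n2 * n4) * (of_int n3 * w)) (of_int (n1 * n2 * n3) * (of_int n4 * z))"
    by (simp add: *(5) quad_scale mult_ac)
  also have "\<dots> \<in> lattice" using n(5-8) by (intro latticeI) (rule Ints_mult[OF Ints_of_int], assumption)+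
  finally show ?thesis using n by (intro exI[of _ ?N]) auto
qed

lemma lattice_int_mult: "x \<in> lattice \<Longrightarrow> of_int N * x \<in> lattice"
  by (rule lattice_mult[OF Ints_subset_lattice[OF Ints_of_int]])

lemma common_denominator:
  assumes "x \<in> span"
  shows "\<exists>N::int. N > 0 \<and> (\<forall>j<n. of_int N * x ^ j \<in> lattice)"
proof (induction n)
  case (Suc n)
  then obtain N :: int where N: "N > 0" "\<forall>j<n. of_int N * x ^ j \<in> lattice" by blast
  obtain M :: int where M: "M > 0" "of_int M * x ^ n \<in> lattice"
    using span_denominator[OF span_power[OF assms]] by blast
  have "of_int (M * N) * x ^ j \<in> lattice" if "j < Suc n" for j
  proof (cases "j = n")
    case True
    then show ?thesis using lattice_int_mult[OF M(2), of N] by (simp add: mult_ac)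
  next
    case False
    then show ?thesis using lattice_int_mult[of "of_int N * x ^ j" M] N(2) that by (simp add: mult_ac)
  qed
  then show ?case using M(1) N(1) by (intro exI[of _ "M * N"]) auto
qed (auto intro: exI[of _ 1])

text \<open>A common denominator of the powers below the degree serves for all powers, because the
  monic equation reduces higher powers with integer coefficients.\<close>

lemma algebraic_int_imp_almost_integral:
  assumes "x \<in> span" "algebraic_int x"
  shows "almost_integral x"
proof -
  from assms(2) obtain f where f: "lead_coeff f = 1" "\<forall>i. coeff f i \<in> \<int>" "poly f x = 0"
    by (auto elim: algebraic_int.cases)
  define n where "n = degree f"
  have "(\<Sum>i\<le>n. coeff f i * x ^ i) = 0" using f(3) by (simp add: poly_altdef n_def)
  then have xn: "x ^ n = (\<Sum>i<n. - coeff f i * x ^ i)"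
    using f(1) by (simp add: n_def lessThan_Suc_atMost[symmetric] sum_negf)
  obtain N :: int where N: "N > 0" "\<forall>j<n. of_int N * x ^ j \<in> lattice"
    using common_denominator[OF assms(1)] by blast
  have "of_int N * x ^ k \<in> lattice" for k
  proof (induction k rule: less_induct)
    case (less k)
    show ?case
    proof (cases "k < n")
      case False
      then have "x ^ k = x ^ (k - n) * x ^ n" by (simp add: power_add[symmetric])
      then have "of_int N * x ^ k = (\<Sum>i<n. - coeff f i * (of_int N * x ^ (k - n + i)))"
        by (simp add: xn sum_distrib_left power_add mult_ac)
      also have "\<dots> \<in> lattice"
      proof (rule lattice_sum)
        fix i assume "i \<in> {..<n}"
        then have "of_int N * x ^ (k - n + i) \<in> lattice" using False by (intro less) auto
        then show "- coeff f i * (of_int N * x ^ (k - n + i)) \<in> lattice"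
          using f(2) by (rule_tac lattice_mult[OF Ints_subset_lattice]) auto
      qed
      finally show ?thesis .
    qed (use N in auto)
  qed
  then show ?thesis using N(1) by (auto simp: almost_integral_def)
qed

text \<open>In the binomial expansion each term needs only the two denominators \<open>M\<close> and
  \<open>N\<close>, which do not depend on the exponents.\<close>

lemma almost_integral_add:
  assumes "almost_integral x" "almost_integral y"
  shows "almost_integral (x + y)"
proof -
  from assms obtain M N :: int where MN: "M > 0" "N > 0"
    "\<And>k. of_int M * x ^ k \<in> lattice" "\<And>k. of_int N * y ^ k \<in> lattice"
    by (auto simp: almost_integral_def)
  have "of_int (M * N) * (x + y) ^ k \<in> lattice" for k
  proof -
    have "of_int (M * N) * (x + y) ^ k =
        (\<Sum>j\<le>k. of_int (int (k choose j)) * ((of_int M * x ^ j) * (of_int N * y ^ (k - j))))"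
      by (simp add: binomial_ring sum_distrib_left mult_ac)
    also have "\<dots> \<in> lattice" by (rule lattice_sum, rule lattice_int_mult, rule lattice_mult[OF MN(3,4)])
    finally show ?thesis .
  qed
  then show ?thesis using MN(1,2) by (auto simp: almost_integral_def intro!: exI[of _ "M * N"])
qed

lemma almost_integral_mult:
  assumes "almost_integral x" "almost_integral y"
  shows "almost_integral (x * y)"
proof -
  from assms obtain M N :: int where MN: "M > 0" "N > 0"
    "\<And>k. of_int M * x ^ k \<in> lattice" "\<And>k. of_int N * y ^ k \<in> lattice"
    by (auto simp: almost_integral_def)
  have "of_int (M * N) * (x * y) ^ k \<in> lattice" for k
    using lattice_mult[OF MN(3)[of k] MN(4)[of k]] by (simp add: power_mult_distrib mult_ac)
  then show ?thesis using MN(1,2) by (auto simp: almost_integral_def intro!: exI[of _ "M * N"])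
qed

text \<open>All powers of the reduced denominator divide one fixed \<open>N\<close>, so it is
  1.\<close>

lemma almost_integral_rational:
  assumes "almost_integral x" "x \<in> \<rat>"
  shows "x \<in> \<int>"
proof -
  from assms(1) obtain N :: int where N: "N > 0" "\<And>k. of_int N * x ^ k \<in> lattice"
    by (auto simp: almost_integral_def)
  obtain s t :: int where st: "t > 0" "coprime s t" "x = of_int s / of_int t"
    using assms(2) by (auto elim: Rats_cases')
  have dvd: "t ^ k dvd N" for k
  proof -
    from N(2)[of k] obtain u v w z where uvwz: "u \<in> \<int>" "v \<in> \<int>" "w \<in> \<int>" "z \<in> \<int>"
      "of_int N * x ^ k = quad u v w z" by (rule latticeE)
    have "quad (of_int N * x ^ k) 0 0 0 = quad u v w z" using uvwz(5) by (simp add: quad_def)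
    then have "of_int N * x ^ k = u"
      using quad_inject[of "of_int N * x ^ k" 0 0 0 u v w z] uvwz(1-4) assms(2) Ints_subset_Rats by auto
    then obtain m where "of_int N * x ^ k = of_int m" using uvwz(1) by (auto elim: Ints_cases)
    then have "real_of_int (N * s ^ k) = of_int (m * t ^ k)"
      using st by (simp add: power_divide field_simps)
    then have "N * s ^ k = m * t ^ k" by linarith
    then have "t ^ k dvd N * s ^ k" by simp
    moreover have "coprime (t ^ k) (s ^ k)" using st(2) by (simp add: coprime_commute)
    ultimately show ?thesis by (simp add: coprime_dvd_mult_left_iff)
  qed
  have "t = 1"
  proof (rule ccontr)
    assume "t \<noteq> 1"
    then have "t \<ge> 2" using st(1) by simp
    then have "2 ^ nat N \<le> t ^ nat N" by (intro power_mono) auto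
    also have "\<dots> \<le> N" using dvd[of "nat N"] N(1) by (intro zdvd_imp_le)
    finally have "2 ^ nat N \<le> N" .
    moreover have "int (nat N) < 2 ^ nat N" by (metis of_nat_less_two_power)
    ultimately show False using N(1) by simp
  qed
  then show ?thesis using st(3) by simp
qed

text \<open>Because \<open>P * Q = c * R\<close>, the nontrivial automorphisms change exactly two of
  the three signs. They commute with powers and preserve the lattice, so the same \<open>N\<close>
  works.\<close>

lemma almost_integral_conjugate:
  assumes "almost_integral (quad u v w z)" "u \<in> \<rat>" "v \<in> \<rat>" "w \<in> \<rat>" "z \<in> \<rat>"
    and e: "(e1, e2, e3) \<in> {(1, -1, -1), (-1, 1, -1), (-1, -1, 1 :: real)}"
  shows "almost_integral (quad u (e1 * v) (e2 * w) (e3 * z))"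
proof -
  from assms(1) obtain N :: int where N: "N > 0" "\<And>k. of_int N * (quad u v w z) ^ k \<in> lattice"
    by (auto simp: almost_integral_def)
  have pow: "\<exists>u'\<in>\<rat>. \<exists>v'\<in>\<rat>. \<exists>w'\<in>\<rat>. \<exists>z'\<in>\<rat>. quad u v w z ^ k = quad u' v' w' z' \<and>
      quad u (e1 * v) (e2 * w) (e3 * z) ^ k = quad u' (e1 * v') (e2 * w') (e3 * z')" for k
  proof (induction k)
    case 0
    show ?case by (intro bexI[of _ 1] bexI[of _ 0]) (auto simp: quad_def)
  next
    case (Suc k)
    then obtain u' v' w' z' where *: "u' \<in> \<rat>" "v' \<in> \<rat>" "w' \<in> \<rat>" "z' \<in> \<rat>"
      "quad u v w z ^ k = quad u' v' w' z'"
      "quad u (e1 * v) (e2 * w) (e3 * z) ^ k = quad u' (e1 * v') (e2 * w') (e3 * z')" by blast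
    let ?u = "u * u' + of_int (b * c) * (v * v') + of_int (a * c) * (w * w') + of_int (a * b) * (z * z')"
      and ?v = "u * v' + v * u' + of_int a * (w * z' + z * w')"
      and ?w = "u * w' + w * u' + of_int b * (v * z' + z * v')"
      and ?z = "u * z' + z * u' + of_int c * (v * w' + w * v')"
    have "?u \<in> \<rat>" "?v \<in> \<rat>" "?w \<in> \<rat>" "?z \<in> \<rat>"
      using *(1-4) assms(2-5) by auto
    moreover have "quad u v w z ^ Suc k = quad ?u ?v ?w ?z"
      unfolding power_Suc *(5) quad_mult ..
    moreover have "quad u (e1 * v) (e2 * w) (e3 * z) ^ Suc k = quad ?u (e1 * ?v) (e2 * ?w) (e3 * ?z)"
      unfolding power_Suc *(6) quad_mult using e by (auto simp: algebra_simps)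
    ultimately show ?case by blast
  qed
  have "of_int N * quad u (e1 * v) (e2 * w) (e3 * z) ^ k \<in> lattice" for k
  proof -
    obtain u' v' w' z' where *: "u' \<in> \<rat>" "v' \<in> \<rat>" "w' \<in> \<rat>" "z' \<in> \<rat>"
      "quad u v w z ^ k = quad u' v' w' z'"
      "quad u (e1 * v) (e2 * w) (e3 * z) ^ k = quad u' (e1 * v') (e2 * w') (e3 * z')" using pow[of k] by blast
    let ?N = "of_int N :: real"
    from N(2)[of k] obtain x1 x2 x3 x4 where x: "x1 \<in> \<int>" "x2 \<in> \<int>" "x3 \<in> \<int>" "x4 \<in> \<int>"
      "?N * quad u v w z ^ k = quad x1 x2 x3 x4" by (rule latticeE)
    have "quad (?N * u') (?N * v') (?N * w') (?N * z') = quad x1 x2 x3 x4"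
      using x(5) unfolding *(5) quad_scale .
    then have "?N * u' = x1 \<and> ?N * v' = x2 \<and> ?N * w' = x3 \<and> ?N * z' = x4"
      using *(1-4) x(1-4) Ints_subset_Rats by (intro quad_inject) auto
    then have "?N * quad u (e1 * v) (e2 * w) (e3 * z) ^ k = quad x1 (e1 * x2) (e2 * x3) (e3 * x4)"
      unfolding *(6) quad_scale by (simp add: mult.left_commute)
    also have "\<dots> \<in> lattice" using e x by (auto intro!: latticeI)
    finally show ?thesis .
  qed
  then show ?thesis using N(1) by (auto simp: almost_integral_def)
qed

section \<open>Denominators of integral elements by traces and norms\<close>

text \<open>In a quadratic subfield the trace \<open>2 * u\<close> and the norm
  \<open>u * u - n * (t * t)\<close> are rational, hence integers. Then \<open>n * (2 * t)^2\<close>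
  is an integer, and a square-free \<open>n\<close> cannot absorb a denominator of
  \<open>2 * t\<close>. The alternatives in \<open>one\<close> cover the three subfields.\<close>

lemma almost_integral_quadratic:
  assumes int: "almost_integral (quad u v w z)" and rat: "u \<in> \<rat>" "v \<in> \<rat>" "w \<in> \<rat>" "z \<in> \<rat>"
    and one: "(w = 0 \<and> z = 0 \<and> t = v \<and> n = b * c) \<or> (v = 0 \<and> z = 0 \<and> t = w \<and> n = a * c)
      \<or> (v = 0 \<and> w = 0 \<and> t = z \<and> n = a * b)"
  shows "\<exists>x y. u = of_int x / 2 \<and> t = of_int y / 2 \<and> 4 dvd x * x - n * (y * y)"
proof -
  have t: "t \<in> \<rat>" and sq: "squarefree n" using one rat sqfree by auto
  have conj: "almost_integral (quad u (- v) (- w) (- z))"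
    using one almost_integral_conjugate[OF int rat, of "-1" 1 "-1"]
      almost_integral_conjugate[OF int rat, of "-1" "-1" 1] almost_integral_conjugate[OF int rat, of 1 "-1" "-1"]
    by auto
  have "quad u v w z + quad u (- v) (- w) (- z) = 2 * u" by (simp add: quad_def)
  with almost_integral_add[OF int conj] have "2 * u \<in> \<int>"
    using rat(1) by (intro almost_integral_rational) auto
  then obtain x where x: "2 * u = of_int x" by (elim Ints_cases)
  have "quad u v w z * quad u (- v) (- w) (- z) = u * u - of_int n * (t * t)"
    unfolding quad_mult using one by (auto simp: quad_def)
  with almost_integral_mult[OF int conj] have "u * u - of_int n * (t * t) \<in> \<int>"
    using rat(1) t by (intro almost_integral_rational) auto
  then obtain m where m: "u * u - of_int n * (t * t) = of_int m" by (elim Ints_cases)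
  have "of_int n * (2 * t)\<^sup>2 = (2 * u) * (2 * u) - 4 * (u * u - of_int n * (t * t))"
    by (simp add: power2_eq_square algebra_simps)
  also have "\<dots> = of_int (x * x - 4 * m)" unfolding x m by simp
  finally have eq: "of_int n * (2 * t)\<^sup>2 = real_of_int (x * x - 4 * m)" .
  have "2 * t \<in> \<rat>" using t by simp
  moreover have "of_int n * (2 * t)\<^sup>2 \<in> \<int>" unfolding eq by (rule Ints_of_int)
  ultimately have "2 * t \<in> \<int>" by (rule squarefree_mult_square_IntsD[OF sq])
  then obtain y where y: "2 * t = of_int y" by (elim Ints_cases)
  have "real_of_int (n * (y * y)) = of_int (x * x - 4 * m)" using eq unfolding y by (simp add: power2_eq_square)
  then have "n * (y * y) = x * x - 4 * m" by linarith
  then have "4 dvd x * x - n * (y * y)" by simp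
  then show ?thesis using x y by (intro exI[of _ x] exI[of _ y]) auto
qed

text \<open>Relative traces to the three quadratic subfields double two coordinates and kill the
  others, so quarters suffice; they give the first three congruences. The relative norm to the field
  of \<open>P\<close> gives the relations with \<open>M\<close> and \<open>N\<close>.\<close>

lemma integer_coordinates:
  assumes "x \<in> span" "algebraic_int x"
  obtains A B C D M N :: int where
    "x = quad (of_int A / 4) (of_int B / 4) (of_int C / 4) (of_int D / 4)"
    "4 dvd A * A - b * c * (B * B)" "4 dvd A * A - a * c * (C * C)" "4 dvd A * A - a * b * (D * D)"
    "8 * M = A * A + b * c * (B * B) - a * c * (C * C) - a * b * (D * D)"
    "4 * N = A * B - a * (C * D)"
    "4 dvd M * M - b * c * (N * N)"
proof -
  from assms(1) obtain u v w z where rat: "u \<in> \<rat>" "v \<in> \<rat>" "w \<in> \<rat>" "z \<in> \<rat>" and x: "x = quad u v w z"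
    by (rule spanE)
  have int: "almost_integral (quad u v w z)" using algebraic_int_imp_almost_integral[OF assms] x by simp
  have c1: "almost_integral (quad u v (- w) (- z))" and c2: "almost_integral (quad u (- v) w (- z))"
    and c3: "almost_integral (quad u (- v) (- w) z)"
    using almost_integral_conjugate[OF int rat, of "-1" 1 "-1"]
      almost_integral_conjugate[OF int rat, of "-1" "-1" 1] almost_integral_conjugate[OF int rat, of 1 "-1" "-1"]
    by auto
  have s1: "almost_integral (quad (2 * u) (2 * v) 0 0)" and s2: "almost_integral (quad (2 * u) 0 (2 * w) 0)"
    and s3: "almost_integral (quad (2 * u) 0 0 (2 * z))"
    using almost_integral_add[OF int c1] almost_integral_add[OF int c2] almost_integral_add[OF int c3]
    by (simp_all add: quad_add)
  obtain A B where AB: "2 * u = of_int A / 2" "2 * v = of_int B / 2" "4 dvd A * A - b * c * (B * B)"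
    using almost_integral_quadratic[OF s1, of "2 * v" "b * c"] rat by auto
  obtain A1 C where AC: "2 * u = of_int A1 / 2" "2 * w = of_int C / 2" "4 dvd A1 * A1 - a * c * (C * C)"
    using almost_integral_quadratic[OF s2, of "2 * w" "a * c"] rat by auto
  obtain A2 D where AD: "2 * u = of_int A2 / 2" "2 * z = of_int D / 2" "4 dvd A2 * A2 - a * b * (D * D)"
    using almost_integral_quadratic[OF s3, of "2 * z" "a * b"] rat by auto
  have A12: "A1 = A" "A2 = A" using AB(1) AC(1) AD(1) by auto
  let ?m = "u * u + of_int (b * c) * (v * v) - of_int (a * c) * (w * w) - of_int (a * b) * (z * z)"
  let ?n = "2 * (u * v - of_int a * (w * z))"
  have "quad u v w z * quad u v (- w) (- z) = quad ?m ?n 0 0"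
    unfolding quad_mult by (simp add: quad_def algebra_simps)
  then have "almost_integral (quad ?m ?n 0 0)" using almost_integral_mult[OF int c1] by simp
  moreover have "?m \<in> \<rat>" "?n \<in> \<rat>" using rat by auto
  ultimately obtain M N where MN: "?m = of_int M / 2" "?n = of_int N / 2" "4 dvd M * M - b * c * (N * N)"
    using almost_integral_quadratic[of ?m ?n 0 0 ?n "b * c"] by auto
  have uvwz: "u = of_int A / 4" "v = of_int B / 4" "w = of_int C / 4" "z = of_int D / 4"
    using AB AC AD by auto
  have "real_of_int (8 * M) = of_int (A * A + b * c * (B * B) - a * c * (C * C) - a * b * (D * D))"
    using MN(1) unfolding uvwz by (simp add: field_simps)
  then have M: "8 * M = A * A + b * c * (B * B) - a * c * (C * C) - a * b * (D * D)" by linarith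
  have "real_of_int (4 * N) = of_int (A * B - a * (C * D))"
    using MN(2) unfolding uvwz by (simp add: field_simps)
  then have N: "4 * N = A * B - a * (C * D)" by linarith
  show thesis
    by (rule that[OF _ AB(3) AC(3)[unfolded A12] AD(3)[unfolded A12] M N MN(3)]) (simp only: x uvwz)
qed

lemma quad_divide: "quad (u / d) (v / d) (w / d) (z / d) = quad u v w z / d"
  by (simp add: quad_def add_divide_distrib)

lemma quad_sum: "(\<Sum>i\<in>I. quad (f i) (g i) (h i) (k i)) = quad (sum f I) (sum g I) (sum h I) (sum k I)"
  by (induction I rule: infinite_finite_induct) (simp_all add: quad_add, simp_all add: quad_def)

lemma quad_square:
  fixes A B C D :: int
  shows "(quad (of_int A) (of_int B) (of_int C) (of_int D))\<^sup>2 =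
    quad (of_int (A * A + b * c * (B * B) + a * c * (C * C) + a * b * (D * D)))
      (of_int (2 * (A * B + a * (C * D)))) (of_int (2 * (A * C + b * (B * D))))
      (of_int (2 * (A * D + c * (B * C))))"
proof -
  have cong: "quad u v w z = quad u' v' w' z'" if "u = u'" "v = v'" "w = w'" "z = z'" for u v w z u' v' w' z'
    using that by simp
  show ?thesis unfolding power2_eq_square quad_mult by (rule cong) simp_all
qed

end

section \<open>The generated field as a tower of quadratic extensions\<close>

text \<open>Since \<open>s\<close> may lie in \<open>F\<close>, the norm of \<open>x + y * s\<close>
  can vanish. For nonzero \<open>y\<close> this means that \<open>s\<close> is \<open>x / y\<close>
  up to sign, and the inverse is already in \<open>F\<close>.\<close>

lemma is_subfield_quadratic_extension:
  fixes F :: "real set"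
  assumes F: "is_subfield F" and d: "s * s \<in> F"
  shows "is_subfield {x + y * s | x y. x \<in> F \<and> y \<in> F}" (is "is_subfield ?E")
proof -
  have [intro]: "0 \<in> F" "1 \<in> F" "\<And>x. x \<in> F \<Longrightarrow> - x \<in> F" "\<And>x. x \<in> F \<Longrightarrow> inverse x \<in> F"
    "\<And>x y. x \<in> F \<Longrightarrow> y \<in> F \<Longrightarrow> x + y \<in> F" "\<And>x y. x \<in> F \<Longrightarrow> y \<in> F \<Longrightarrow> x * y \<in> F"
    using F by (auto simp: is_subfield_def)
  have I: "x + y * s \<in> ?E" if "x \<in> F" "y \<in> F" for x y using that by blast
  have inF: "x \<in> ?E" if "x \<in> F" for x using I[of x 0] that by auto
  have inv: "inverse (x + y * s) \<in> ?E" if xy: "x \<in> F" "y \<in> F" for x y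
  proof (cases "x * x + - (s * s * (y * y)) = 0")
    case False
    let ?N = "x * x + - (s * s * (y * y))"
    have N: "?N = (x + y * s) * (x + - y * s)" by (simp add: algebra_simps)
    have "inverse (x + y * s) = (x + - y * s) * inverse ?N"
    proof -
      have "inverse X = Y * inverse (X * Y)" if "X * Y \<noteq> 0" for X Y :: real using that by simp
      then show ?thesis using False unfolding N by blast
    qed
    also have "\<dots> = x * inverse ?N + (- y * inverse ?N) * s" by (simp add: algebra_simps)
    also have "\<dots> \<in> ?E" using xy d by (intro I) blast+
    finally show ?thesis .
  next
    case True
    show ?thesis
    proof (cases "y = 0")
      case True
      have "inverse x \<in> ?E" using xy by (intro inF) blast
      then show ?thesis using True by simp
    next
      case False
      have "(s + x * inverse y) * (s + - (x * inverse y)) = 0"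
        using True False by (simp add: field_simps)
      then have "s = - (x * inverse y) \<or> s = x * inverse y" by auto
      then have "s \<in> F" using xy by auto
      then show ?thesis using xy by (intro inF) blast
    qed
  qed
  have mult: "(x + y * s) * (x' + y' * s) \<in> ?E" if "x \<in> F" "y \<in> F" "x' \<in> F" "y' \<in> F" for x y x' y'
  proof -
    have "(x + y * s) * (x' + y' * s) = (x * x' + s * s * (y * y')) + (x * y' + y * x') * s"
      by (simp add: algebra_simps)
    also have "\<dots> \<in> ?E" using that d by (intro I) blast+
    finally show ?thesis .
  qed
  have add: "(x + y * s) + (x' + y' * s) \<in> ?E" if "x \<in> F" "y \<in> F" "x' \<in> F" "y' \<in> F" for x y x' y'
    using I[of "x + x'" "y + y'"] that by (auto simp: algebra_simps)
  have minus: "- (x + y * s) \<in> ?E" if "x \<in> F" "y \<in> F" for x y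
    using I[of "- x" "- y"] that by auto
  have one: "- z \<in> ?E" "inverse z \<in> ?E" if z: "z \<in> ?E" for z
  proof -
    obtain x y where "z = x + y * s" "x \<in> F" "y \<in> F" using z by blast
    then show "- z \<in> ?E" "inverse z \<in> ?E" using minus inv by simp_all
  qed
  have two: "z + z' \<in> ?E" "z * z' \<in> ?E" if z: "z \<in> ?E" "z' \<in> ?E" for z z'
  proof -
    obtain x y x' y' where "z = x + y * s" "x \<in> F" "y \<in> F" "z' = x' + y' * s" "x' \<in> F" "y' \<in> F"
      using z by blast
    then show "z + z' \<in> ?E" "z * z' \<in> ?E" using add mult by simp_all
  qed
  show ?thesis unfolding is_subfield_def
    by (intro conjI ballI inF[OF \<open>0 \<in> F\<close>] inF[OF \<open>1 \<in> F\<close>] one two)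
qed

lemma is_subfield_Rats: "is_subfield (\<rat> :: real set)"
  by (auto simp: is_subfield_def)

lemma Rats_subset_subfield: "is_subfield F \<Longrightarrow> \<rat> \<subseteq> F" for F :: "real set"
proof
  fix x :: real assume F: "is_subfield F" and "x \<in> \<rat>"
  then obtain s t :: int where x: "x = of_int s / of_int t" by (auto elim: Rats_cases')
  have "of_nat n \<in> F" for n by (induction n) (use F in \<open>auto simp: is_subfield_def\<close>)
  then have "of_int n \<in> F" for n using F by (cases n rule: int_cases2) (auto simp: is_subfield_def)
  then show "x \<in> F" using F unfolding x divide_inverse is_subfield_def by blast
qed

context biquadratic
begin

lemma is_subfield_span: "is_subfield span"
proof -
  let ?F = "{x + y * P | x y. x \<in> \<rat> \<and> y \<in> \<rat>}"
  have F: "is_subfield ?F"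
    by (rule is_subfield_quadratic_extension[OF is_subfield_Rats]) (simp add: mults)
  have "of_int (a * c) \<in> ?F" using Rats_subset_subfield[OF F] Rats_of_int by blast
  then have "is_subfield {x + y * Q | x y. x \<in> ?F \<and> y \<in> ?F}"
    by (intro is_subfield_quadratic_extension[OF F]) (simp only: mults)
  also have "{x + y * Q | x y. x \<in> ?F \<and> y \<in> ?F} = span"
  proof (intro set_eqI iffI)
    fix x assume "x \<in> {x + y * Q | x y. x \<in> ?F \<and> y \<in> ?F}"
    then obtain u v w z where *: "u \<in> \<rat>" "v \<in> \<rat>" "w \<in> \<rat>" "z \<in> \<rat>" "x = (u + v * P) + (w + z * P) * Q" by blast
    have "x = u + v * P + w * Q + z * (P * Q)" by (simp add: *(5) algebra_simps)
    then have "x = quad u v w (z * of_int c)" by (simp add: mults quad_def)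
    then show "x \<in> span" using * by (auto intro!: spanI)
  next
    fix x assume "x \<in> span"
    then obtain u v w z where *: "u \<in> \<rat>" "v \<in> \<rat>" "w \<in> \<rat>" "z \<in> \<rat>" "x = quad u v w z" by (rule spanE)
    have "R = P * Q / of_int c" using mults(4) pos by simp
    then have "x = (u + v * P) + (w + (z / of_int c) * P) * Q" by (simp add: *(5) quad_def algebra_simps)
    moreover have "z / of_int c \<in> \<rat>" using * by simp
    ultimately show "x \<in> {x + y * Q | x y. x \<in> ?F \<and> y \<in> ?F}" using *(1-3) by blast
  qed
  finally show ?thesis .
qed

lemma rat_adjoin_eq_span: "rat_adjoin {P, Q} = span"
  unfolding rat_adjoin_def
proof (rule hull_unique)
  show "{P, Q} \<subseteq> span" using spanI[of 0 1 0 0] spanI[of 0 0 1 0] by (simp add: quad_def)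
  show "is_subfield span" by (rule is_subfield_span)
  fix F assume PQ: "{P, Q} \<subseteq> F" and F: "is_subfield F"
  have add: "x + y \<in> F" and mult: "x * y \<in> F" if "x \<in> F" "y \<in> F" for x y using F that by (auto simp: is_subfield_def)
  have rat: "x \<in> F" if "x \<in> \<rat>" for x using Rats_subset_subfield[OF F] that by blast
  have "R = inverse (of_int c) * (P * Q)" using mults(4) pos by simp
  moreover have "inverse (of_int c) * (P * Q) \<in> F" using PQ rat[of "inverse (of_int c)"] by (auto intro: mult)
  ultimately have R: "R \<in> F" by simp
  show "span \<subseteq> F"
  proof
    fix x assume "x \<in> span"
    then obtain u v w z where *: "u \<in> \<rat>" "v \<in> \<rat>" "w \<in> \<rat>" "z \<in> \<rat>" "x = quad u v w z" by (rule spanE)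
    have "u \<in> F" "v * P \<in> F" "w * Q \<in> F" "z * R \<in> F" using * PQ R by (auto intro: mult rat)
    then show "x \<in> F" unfolding *(5) quad_def by (intro add)
  qed
qed

end

section \<open>Coordinates of integers modulo 4\<close>

lemma square_minus_parity_dvd_4: "4 dvd x * x - x mod 2" for x :: int
proof (cases "even x")
  case True
  then obtain k where "x = 2 * k" by (rule evenE)
  then show ?thesis by simp
next
  case False
  then obtain k where "x = 2 * k + 1" by (rule oddE)
  then have "x * x - x mod 2 = 4 * (k * k + k)" by (simp add: algebra_simps)
  then show ?thesis by simp
qed

lemma quaternary_form_mod_4:
  fixes p q r :: int
  assumes "4 dvd A * A + p * (B * B) + q * (C * C) + r * (D * D)"
  shows "4 dvd A mod 2 + p * (B mod 2) + q * (C mod 2) + r * (D mod 2)"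
proof -
  have "4 dvd (A * A - A mod 2) + p * (B * B - B mod 2) + q * (C * C - C mod 2) + r * (D * D - D mod 2)"
    by (intro dvd_add dvd_mult square_minus_parity_dvd_4)
  from dvd_diff[OF assms this] show ?thesis by (simp add: algebra_simps)
qed

lemma binary_form_mod_4: "4 dvd A mod 2 - p * (B mod 2)" if "4 dvd A * A - p * (B * B)" for A B p :: int
  using quaternary_form_mod_4[of A "-p" B 0 0 0 0] that by simp

text \<open>Squares are 0 or 1 modulo 4. This is the reason why the integers of a quadratic field
  with radicand 2 or 3 modulo 4 have no denominator 2.\<close>

lemma binary_form_even:
  fixes A B p :: int
  assumes "4 dvd A * A - p * (B * B)" "p mod 4 = 2 \<or> p mod 4 = 3"
  shows "even A" "even B"
proof -
  have "4 dvd A mod 2 - p * (B mod 2)" using assms(1) by (rule binary_form_mod_4)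
  moreover have "A mod 2 = 0 \<or> A mod 2 = 1" "B mod 2 = 0 \<or> B mod 2 = 1" by auto
  ultimately have "A mod 2 = 0 \<and> B mod 2 = 0" using assms(2) by (elim disjE; simp; presburger)
  then show "even A" "even B" by auto
qed

text \<open>Only residues matter, so sixteen parity patterns remain. Condition \<open>e\<close>,
  which stems from the relative norm, removes patterns that \<open>d\<close> alone would admit, such
  as odd \<open>A\<close>, \<open>B\<close> with even \<open>C\<close>, \<open>D\<close> for
  \<open>p\<close> congruent to 3 and \<open>r\<close> congruent to 1.\<close>

lemma parity_pattern_mod_4:
  fixes p q r A B C D :: int
  assumes d: "4 dvd A mod 2 + p * (B mod 2) - q * (C mod 2) - r * (D mod 2)" and e: "even (A * B - C * D)"
    and p: "p mod 4 = 2 \<or> p mod 4 = 3" and q: "q mod 4 = p mod 4"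
  shows "r mod 4 = 1 \<Longrightarrow> even (A + D) \<and> even (B + C)"
    "p mod 4 = 2 \<Longrightarrow> r mod 4 = 3 \<Longrightarrow> even A \<and> even D \<and> even (B + C)"
proof -
  define x y z w where "x = A mod 2" and "y = B mod 2" and "z = C mod 2" and "w = D mod 2"
  have "p = 4 * (p div 4) + p mod 4" "q = 4 * (q div 4) + p mod 4" "r = 4 * (r div 4) + r mod 4"
    using q by (metis mult_div_mod_eq)+
  then obtain p' q' r' where pqr: "p = 4 * p' + p mod 4" "q = 4 * q' + p mod 4" "r = 4 * r' + r mod 4" by blast
  have "x + p * y - q * z - r * w = 4 * (p' * y - q' * z - r' * w) + (x + (p mod 4) * y - (p mod 4) * z - (r mod 4) * w)"
    by (subst pqr(1), subst pqr(2), subst pqr(3)) (simp add: algebra_simps)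
  moreover have "4 dvd x + p * y - q * z - r * w" using d unfolding x_def y_def z_def w_def .
  ultimately have dvd: "4 dvd x + (p mod 4) * y - (p mod 4) * z - (r mod 4) * w"
    by (simp only: dvd_add_right_iff dvd_triv_left)
  have xyzw: "x = 0 \<or> x = 1" "y = 0 \<or> y = 1" "z = 0 \<or> z = 1" "w = 0 \<or> w = 1"
    by (auto simp: x_def y_def z_def w_def)
  have ev: "even A \<longleftrightarrow> x = 0" "even B \<longleftrightarrow> y = 0" "even C \<longleftrightarrow> z = 0" "even D \<longleftrightarrow> w = 0"
    by (auto simp: x_def y_def z_def w_def)
  have e': "(x = 0 \<or> y = 0) = (z = 0 \<or> w = 0)" using e by (simp add: ev)
  show "even (A + D) \<and> even (B + C)" if "r mod 4 = 1"
    unfolding even_add ev using dvd[unfolded that] p xyzw e' by (elim disjE) simp_all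
  show "even A \<and> even D \<and> even (B + C)" if "p mod 4 = 2" "r mod 4 = 3"
    unfolding even_add ev using dvd[unfolded that] xyzw e' by (elim disjE) simp_all
qed

lemma odd_if_mod_4: "x mod 4 = 1 \<or> x mod 4 = 3 \<Longrightarrow> odd x" for x :: int
  by presburger

section \<open>Integrality criteria and sums of squares\<close>

text \<open>Transitivity of integrality for one quadratic step; two such steps replace an explicit
  quartic equation.\<close>

lemma algebraic_int_quadratic:
  fixes x :: real
  assumes "algebraic_int (x * x - of_int j * x)"
  shows "algebraic_int x"
  using assms
proof (rule algebraic_int_root)
  show "poly [:0, - of_int j, 1:] x = x * x - of_int j * x" by (simp add: algebra_simps)
qed (auto simp: coeff_pCons split: nat.splits)

lemma algebraic_int_half:
  fixes t n :: int and s :: real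
  assumes "4 dvd n - t * t" "s * s = of_int n"
  shows "algebraic_int ((of_int t + s) / 2)"
proof (rule algebraic_int_quadratic[of _ t])
  from assms(1) obtain k where k: "n - t * t = 4 * k" by (elim dvdE)
  have "(of_int t + s) / 2 * ((of_int t + s) / 2) - of_int t * ((of_int t + s) / 2) = (s * s - of_int (t * t)) / 4"
    by (simp add: field_simps)
  also have "\<dots> = of_int (n - t * t) / 4" by (simp add: assms(2))
  also have "\<dots> = of_int k" unfolding k by simp
  finally show "algebraic_int ((of_int t + s) / 2 * ((of_int t + s) / 2) - of_int t * ((of_int t + s) / 2))"
    by (simp add: int_imp_algebraic_int)
qed

lemma sums_of_at_most_5_squaresE:
  assumes "x \<in> sums_of_at_most_squares 5 S" "0 \<in> S"
  obtains f :: "nat \<Rightarrow> 'a::comm_ring_1" where "\<forall>i<5. f i \<in> S" "x = (\<Sum>i<5. (f i)\<^sup>2)"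
proof -
  from assms(1) obtain n f where n: "enat n \<le> 5" "\<forall>i<n. f i \<in> S" "x = (\<Sum>i<n. (f i)\<^sup>2)"
    by (auto simp: sums_of_at_most_squares_def)
  have n5: "n \<le> 5" using n(1) by (simp add: numeral_eq_enat)
  \<comment> \<open>Shorter sums are padded with zeros, so that there are exactly five
    summands.\<close>
  define g where "g i = (if i < n then f i else 0)" for i
  have "(\<Sum>i<n. (f i)\<^sup>2) = (\<Sum>i<n. (g i)\<^sup>2)" by (rule sum.cong) (auto simp: g_def)
  also have "\<dots> = (\<Sum>i<5. (g i)\<^sup>2)"
    by (rule sum.mono_neutral_left) (use n5 in \<open>auto simp: g_def\<close>)
  finally show thesis using that[of g] n(2,3) assms(2) by (simp add: g_def)
qed

text \<open>The sets of sums of at most \<open>m\<close> squares grow with \<open>m\<close>, so a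
  single element excludes all \<open>m \<le> 5\<close>.\<close>

lemma pythagoras_number_ge_6I:
  assumes "x \<in> sums_of_squares S" "x \<notin> sums_of_at_most_squares 5 S"
  shows "pythagoras_number S \<ge> 6"
  unfolding pythagoras_number_def
proof (rule Inf_greatest)
  fix m assume "m \<in> {m. sums_of_squares S = sums_of_at_most_squares m S}"
  then have m: "x \<in> sums_of_at_most_squares m S" using assms(1) by simp
  show "6 \<le> m"
  proof (rule ccontr)
    assume "\<not> 6 \<le> m"
    then have "m \<le> 5" by (cases m) (auto simp: numeral_eq_enat)
    then have "sums_of_at_most_squares m S \<subseteq> sums_of_at_most_squares 5 S"
      unfolding sums_of_at_most_squares_def using order_trans by blast
    then show False using m assms(2) by blast
  qed
qed

lemma seven_plus_two_squares:
  fixes x y :: "'a::comm_ring_1"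
  assumes "x \<in> S" "y \<in> S" "1 \<in> S" "2 \<in> S"
  shows "7 + x\<^sup>2 + y\<^sup>2 \<in> sums_of_squares S"
proof -
  \<comment> \<open>The decomposition \<open>7 = 2^2 + 1 + 1 + 1\<close> leads to six
    squares.\<close>
  define f where "f i = [2, 1, 1, 1, x, y] ! i" for i
  have f: "f 0 = 2" "f 1 = 1" "f 2 = 1" "f 3 = 1" "f 4 = x" "f 5 = y"
    by (simp_all add: f_def eval_nat_numeral)
  have six: "{..<6::nat} = {0, 1, 2, 3, 4, 5}" by auto
  have "7 + x\<^sup>2 + y\<^sup>2 = (\<Sum>i<6. (f i)\<^sup>2)" unfolding six using f by simp
  moreover have "\<forall>i<6. f i \<in> S"
  proof (intro allI impI)
    fix i :: nat assume "i < 6"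
    then have "i \<in> {0, 1, 2, 3, 4, 5}" by auto
    then show "f i \<in> S" using assms f by auto
  qed
  ultimately show ?thesis unfolding sums_of_squares_def by blast
qed

context biquadratic
begin

lemma Ints_ring_of_integers: "x \<in> \<int> \<Longrightarrow> x \<in> ring_of_integers span"
  using Ints_subset_Rats Rats_subset_span int_imp_algebraic_int by (auto simp: ring_of_integers_def)

text \<open>The radicands \<open>b * c\<close> and \<open>a * c\<close> are 2 or 3 modulo 4, which
  turns quarters into halves. For the same reason \<open>M\<close> and \<open>N\<close> are even,
  and cancelling these factors yields the last two conditions.\<close>

lemma half_coordinates:
  assumes x: "x \<in> ring_of_integers span"
    and p: "(b * c) mod 4 = 2 \<or> (b * c) mod 4 = 3" and q: "(a * c) mod 4 = (b * c) mod 4" and r: "odd (a * b)"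
  obtains A B C D :: int where "x = quad (of_int A / of_int 2) (of_int B / of_int 2) (of_int C / of_int 2) (of_int D / of_int 2)"
    "4 dvd A mod 2 + b * c * (B mod 2) - a * c * (C mod 2) - a * b * (D mod 2)" "even (A * B - C * D)"
proof -
  from x have "x \<in> span" "algebraic_int x" by (auto simp: ring_of_integers_def)
  then obtain A B C D M N :: int where
    x: "x = quad (of_int A / 4) (of_int B / 4) (of_int C / 4) (of_int D / 4)" and
    dv: "4 dvd A * A - b * c * (B * B)" "4 dvd A * A - a * c * (C * C)" "4 dvd A * A - a * b * (D * D)" and
    M: "8 * M = A * A + b * c * (B * B) - a * c * (C * C) - a * b * (D * D)" and
    N: "4 * N = A * B - a * (C * D)" and MN: "4 dvd M * M - b * c * (N * N)"
    by (rule integer_coordinates)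
  have AB: "even A" "even B" using binary_form_even[OF dv(1) p] by auto
  have C: "even C" using binary_form_even[OF dv(2)] p q by simp
  have D: "even D"
  proof (rule ccontr)
    assume "odd D"
    then have "odd (A * A - a * b * (D * D))" using AB r by simp
    then show False using dv(3) by (meson dvd_trans even_numeral)
  qed
  obtain A' B' C' D' where d: "A = 2 * A'" "B = 2 * B'" "C = 2 * C'" "D = 2 * D'"
    using AB C D by (metis evenE)
  have MN': "even M" "even N" using binary_form_even[OF MN p] by auto
  then obtain M' where M': "M = 2 * M'" by (elim evenE)
  have "4 * M' = A' * A' + b * c * (B' * B') - a * c * (C' * C') - a * b * (D' * D')"
    using M unfolding d M' by (simp add: algebra_simps)
  then have "4 dvd A' * A' + b * c * (B' * B') + (- (a * c)) * (C' * C') + (- (a * b)) * (D' * D')"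
    by (metis add_uminus_conv_diff dvd_triv_left mult_minus_left)
  from quaternary_form_mod_4[OF this]
  have 1: "4 dvd A' mod 2 + b * c * (B' mod 2) - a * c * (C' mod 2) - a * b * (D' mod 2)" by simp
  have "N = A' * B' - a * (C' * D')" using N unfolding d by (simp add: algebra_simps)
  then have 2: "even (A' * B' - C' * D')" using MN' r by auto
  show thesis by (rule that[OF _ 1 2]) (simp add: x d)
qed

lemma type_B1_coordinates:
  assumes x: "x \<in> ring_of_integers span"
    and p: "(b * c) mod 4 = 2 \<or> (b * c) mod 4 = 3" and q: "(a * c) mod 4 = (b * c) mod 4" and r: "(a * b) mod 4 = 1"
  shows "\<exists>A B C D :: int. x = quad (of_int A / of_int 2) (of_int B / of_int 2) (of_int C / of_int 2) (of_int D / of_int 2)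
    \<and> even (A + D) \<and> even (B + C)"
proof -
  have "odd (a * b)" using r by (intro odd_if_mod_4) simp
  from half_coordinates[OF x p q this] obtain A B C D :: int where
    x: "x = quad (of_int A / of_int 2) (of_int B / of_int 2) (of_int C / of_int 2) (of_int D / of_int 2)" and
    d: "4 dvd A mod 2 + b * c * (B mod 2) - a * c * (C mod 2) - a * b * (D mod 2)" and e: "even (A * B - C * D)"
    by blast
  have "even (A + D) \<and> even (B + C)" by (rule parity_pattern_mod_4(1)[OF d e p q r])
  then show ?thesis using x by blast
qed

lemma type_B2_coordinates:
  assumes x: "x \<in> ring_of_integers span"
    and p: "(b * c) mod 4 = 2" and q: "(a * c) mod 4 = 2" and r: "(a * b) mod 4 = 3"
  shows "\<exists>A B C D :: int. x = quad (of_int A / of_int 2) (of_int B / of_int 2) (of_int C / of_int 2) (of_int D / of_int 2)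
    \<and> even A \<and> even D \<and> even (B + C)"
proof -
  have "odd (a * b)" using r by (intro odd_if_mod_4) simp
  with x p q obtain A B C D :: int where
    x: "x = quad (of_int A / of_int 2) (of_int B / of_int 2) (of_int C / of_int 2) (of_int D / of_int 2)" and
    d: "4 dvd A mod 2 + b * c * (B mod 2) - a * c * (C mod 2) - a * b * (D mod 2)" and e: "even (A * B - C * D)"
    by (elim half_coordinates[rotated 4]) auto
  have "even A \<and> even D \<and> even (B + C)"
    by (rule parity_pattern_mod_4(2)[OF d e _ _ p r]) (simp_all add: p q)
  then show ?thesis using x by blast
qed

text \<open>All radicands are 1 modulo 4, so quarters can persist. If the coordinates are even, the
  halved relative norm equals \<open>2 * M\<close>, which makes the sum of the halved coordinates
  even.\<close>

lemma type_A_coordinates: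
  assumes x: "x \<in> ring_of_integers span"
    and p: "(b * c) mod 4 = 1" and q: "(a * c) mod 4 = 1" and r: "(a * b) mod 4 = 1"
  shows "\<exists>A B C D :: int. x = quad (of_int A / of_int 4) (of_int B / of_int 4) (of_int C / of_int 4) (of_int D / of_int 4)
    \<and> even (A + B) \<and> even (A + C) \<and> even (A + D) \<and> (even A \<longrightarrow> 4 dvd A + B + C + D)"
proof -
  from x have "x \<in> span" "algebraic_int x" by (auto simp: ring_of_integers_def)
  then obtain A B C D M N :: int where
    x: "x = quad (of_int A / 4) (of_int B / 4) (of_int C / 4) (of_int D / 4)" and
    dv: "4 dvd A * A - b * c * (B * B)" "4 dvd A * A - a * c * (C * C)" "4 dvd A * A - a * b * (D * D)" and
    M: "8 * M = A * A + b * c * (B * B) - a * c * (C * C) - a * b * (D * D)"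
    by (rule integer_coordinates)
  have odds: "odd (b * c)" "odd (a * c)" "odd (a * b)" using p q r by (intro odd_if_mod_4; simp)+
  have "even (A * A - b * c * (B * B))" "even (A * A - a * c * (C * C))" "even (A * A - a * b * (D * D))"
    using dv by (meson dvd_trans even_numeral)+
  then have par: "even (A + B)" "even (A + C)" "even (A + D)" using odds by auto
  have "4 dvd A + B + C + D" if evA: "even A"
  proof -
    obtain A' B' C' D' where d: "A = 2 * A'" "B = 2 * B'" "C = 2 * C'" "D = 2 * D'"
      using evA par by (metis evenE even_add)
    have "4 * (2 * M) = 8 * M" by simp
    also have "\<dots> = 4 * (A' * A' + b * c * (B' * B') - a * c * (C' * C') - a * b * (D' * D'))"
      unfolding M d by (simp add: algebra_simps)
    finally have "2 * M = A' * A' + b * c * (B' * B') - a * c * (C' * C') - a * b * (D' * D')"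
      by (simp only: mult_cancel_left) simp
    then have "even (A' * A' + b * c * (B' * B') - a * c * (C' * C') - a * b * (D' * D'))"
      by (metis dvd_triv_left)
    then have "even (A' + B' + C' + D')" using odds by auto
    then show ?thesis unfolding d by presburger
  qed
  then show ?thesis using x par by (intro exI[of _ A] exI[of _ B] exI[of _ C] exI[of _ D]) auto
qed

lemma five_squares_equations:
  fixes d :: int
  assumes d: "d \<noteq> 0"
    and eq: "(\<Sum>i<5. (quad (of_int (A i) / of_int d) (of_int (B i) / of_int d) (of_int (C i) / of_int d) (of_int (D i) / of_int d))\<^sup>2)
      = quad (of_int n0 / of_int (d * d)) (of_int n1 / of_int (d * d)) (of_int n2 / of_int (d * d)) (of_int n3 / of_int (d * d))"
  shows "dot A A + b * c * dot B B + a * c * dot C C + a * b * dot D D = n0"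
    "2 * (dot A B + a * dot C D) = n1" "2 * (dot A C + b * dot B D) = n2" "2 * (dot A D + c * dot B C) = n3"
proof -
  let ?S0 = "\<Sum>i<5. A i * A i + b * c * (B i * B i) + a * c * (C i * C i) + a * b * (D i * D i)"
    and ?S1 = "\<Sum>i<5. 2 * (A i * B i + a * (C i * D i))"
    and ?S2 = "\<Sum>i<5. 2 * (A i * C i + b * (B i * D i))"
    and ?S3 = "\<Sum>i<5. 2 * (A i * D i + c * (B i * C i))"
  have "(\<Sum>i<5. (quad (of_int (A i)) (of_int (B i)) (of_int (C i)) (of_int (D i)))\<^sup>2) / of_int (d * d) =
      quad (of_int n0) (of_int n1) (of_int n2) (of_int n3) / of_int (d * d)"
    using eq unfolding quad_divide power_divide sum_divide_distrib[symmetric] by (simp add: power2_eq_square)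
  then have "(\<Sum>i<5. (quad (of_int (A i)) (of_int (B i)) (of_int (C i)) (of_int (D i)))\<^sup>2) =
      quad (of_int n0) (of_int n1) (of_int n2) (of_int n3)"
    using d by simp
  then have "quad (of_int ?S0) (of_int ?S1) (of_int ?S2) (of_int ?S3) =
      quad (of_int n0) (of_int n1) (of_int n2) (of_int n3)"
    unfolding quad_square quad_sum of_int_sum .
  then have "real_of_int ?S0 = of_int n0 \<and> real_of_int ?S1 = of_int n1
      \<and> real_of_int ?S2 = of_int n2 \<and> real_of_int ?S3 = of_int n3"
    by (intro quad_inject) (auto simp only: Rats_of_int)
  then have "?S0 = n0" "?S1 = n1" "?S2 = n2" "?S3 = n3" unfolding of_int_eq_iff by blast+
  then show "dot A A + b * c * dot B B + a * c * dot C C + a * b * dot D D = n0"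
    "2 * (dot A B + a * dot C D) = n1" "2 * (dot A C + b * dot B D) = n2" "2 * (dot A D + c * dot B C) = n3"
    by (simp_all add: dot_def sum.distrib sum_distrib_left)
qed

text \<open>The square of the half sum is \<open>Z = (j + e * c * R) / 2\<close>, which has trace
  \<open>j\<close> and norm \<open>h * h\<close> over the rationals. Integrality is thus obtained
  through the field of \<open>R\<close>; the shift by \<open>k\<close> only changes the
  coefficients.\<close>

lemma algebraic_int_half_sum:
  fixes k :: int
  assumes h: "4 dvd c * (a - b)" "even (c * (a + b))" and e: "(e1, e2) \<in> {(1, 1), (1, -1), (-1, 1 :: real)}"
  shows "algebraic_int (of_int k + (e1 * P + e2 * Q) / 2)"
proof -
  obtain h j where hj: "c * (a - b) = 4 * h" "c * (a + b) = 2 * j" using assms by (meson dvdE)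
  define e where "e = e1 * e2"
  have ee: "e * e = 1" "e1 * e1 = 1" "e2 * e2 = 1" using e by (auto simp: e_def)
  define Z where "Z = (of_int j + e * of_int c * R) / 2"
  have jr: "real_of_int c * of_int b + of_int c * of_int a = 2 * of_int j"
    using arg_cong[OF hj(2), of real_of_int] by (simp add: algebra_simps)
  have "((e1 * P + e2 * Q) / 2) * ((e1 * P + e2 * Q) / 2) = ((e1 * e1) * (P * P) + (e2 * e2) * (Q * Q) + 2 * e * (P * Q)) / 4"
    by (simp add: e_def field_simps)
  also have "\<dots> = Z" unfolding mults ee Z_def using jr by (simp add: field_simps)
  finally have Z: "((e1 * P + e2 * Q) / 2) * ((e1 * P + e2 * Q) / 2) = Z" .
  have "4 * (j * j) - 16 * (h * h) = (2 * j) * (2 * j) - (4 * h) * (4 * h)" by simp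
  also have "\<dots> = 4 * (c * c * (a * b))" unfolding hj[symmetric] by (simp add: algebra_simps)
  finally have "c * c * (a * b) = j * j - 4 * (h * h)" by simp
  then have hr: "of_int (c * c * (a * b)) = (of_int (j * j - 4 * (h * h)) :: real)" by simp
  have "Z * Z - of_int j * Z = ((e * e) * (of_int c * of_int c * (R * R)) - of_int (j * j)) / 4"
    by (simp add: Z_def field_simps)
  also have "\<dots> = (of_int (c * c * (a * b)) - of_int (j * j)) / 4" unfolding mults ee by simp
  also have "\<dots> = - of_int (h * h)" unfolding hr by simp
  finally have ZZ: "Z * Z - of_int j * Z = - of_int (h * h)" .
  let ?x = "of_int k + (e1 * P + e2 * Q) / 2"
  have x: "?x * ?x - of_int (2 * k) * ?x = Z - of_int (k * k)" unfolding Z[symmetric] by (simp add: field_simps)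
  let ?y = "Z - of_int (k * k)"
  have "?y * ?y - of_int (j - 2 * (k * k)) * ?y = (Z * Z - of_int j * Z) + of_int (j * (k * k) - k * k * (k * k))"
    by (simp add: algebra_simps)
  also have "\<dots> = of_int (- (h * h) + (j * (k * k) - k * k * (k * k)))" unfolding ZZ by simp
  finally have "algebraic_int (?y * ?y - of_int (j - 2 * (k * k)) * ?y)" by (simp only: int_imp_algebraic_int Ints_of_int)
  then have "algebraic_int ?y" by (rule algebraic_int_quadratic)
  then have "algebraic_int (?x * ?x - of_int (2 * k) * ?x)" unfolding x .
  then show ?thesis by (rule algebraic_int_quadratic)
qed

end

section \<open>Elements that are not sums of five squares\<close>

context biquadratic
begin

lemma ring_of_integersI: "u \<in> \<rat> \<Longrightarrow> v \<in> \<rat> \<Longrightarrow> w \<in> \<rat> \<Longrightarrow> z \<in> \<rat> \<Longrightarrow> quad u v w z = x \<Longrightarrow> algebraic_int x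
    \<Longrightarrow> quad u v w z \<in> ring_of_integers span"
  by (auto simp: ring_of_integers_def intro: spanI)

text \<open>The interface between the field and the integer systems: \<open>d\<close> is the
  denominator of integral coordinates, \<Phi> collects the congruences between the numerators, and
  \<open>ka\<close> to \<open>kd\<close> are the numerators of \<alpha> over \<open>d * d\<close>.
  Only \<open>nosol\<close> depends on sizes.\<close>

lemma pythagoras_number_ge_6_if_no_solution:
  fixes d ka kb kc kd :: int
  assumes d: "d \<noteq> 0" and xy: "x \<in> ring_of_integers span" "y \<in> ring_of_integers span"
    and eq: "7 + x\<^sup>2 + y\<^sup>2 =
      quad (of_int ka / of_int (d * d)) (of_int kb / of_int (d * d)) (of_int kc / of_int (d * d)) (of_int kd / of_int (d * d))"
    and coords: "\<And>z. z \<in> ring_of_integers span \<Longrightarrow> \<exists>A B C D :: int.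
      z = quad (of_int A / of_int d) (of_int B / of_int d) (of_int C / of_int d) (of_int D / of_int d) \<and> \<Phi> A B C D"
    and nosol: "\<And>A B C D. (\<And>i. i < 5 \<Longrightarrow> \<Phi> (A i) (B i) (C i) (D i)) \<Longrightarrow>
      dot A A + b * c * dot B B + a * c * dot C C + a * b * dot D D = ka \<Longrightarrow>
      2 * (dot A B + a * dot C D) = kb \<Longrightarrow> 2 * (dot A C + b * dot B D) = kc \<Longrightarrow>
      2 * (dot A D + c * dot B C) = kd \<Longrightarrow> False"
  shows "pythagoras_number (ring_of_integers span) \<ge> 6"
proof (rule pythagoras_number_ge_6I)
  show "7 + x\<^sup>2 + y\<^sup>2 \<in> sums_of_squares (ring_of_integers span)"
    by (rule seven_plus_two_squares[OF xy]) (rule Ints_ring_of_integers, simp)+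
  show "7 + x\<^sup>2 + y\<^sup>2 \<notin> sums_of_at_most_squares 5 (ring_of_integers span)"
  proof
    assume "7 + x\<^sup>2 + y\<^sup>2 \<in> sums_of_at_most_squares 5 (ring_of_integers span)"
    moreover have "0 \<in> ring_of_integers span" by (rule Ints_ring_of_integers) simp
    ultimately obtain f :: "nat \<Rightarrow> real" where f: "\<forall>i<5. f i \<in> ring_of_integers span" "7 + x\<^sup>2 + y\<^sup>2 = (\<Sum>i<5. (f i)\<^sup>2)"
      by (rule sums_of_at_most_5_squaresE)
    have "\<forall>i. \<exists>A B C D :: int. i < 5 \<longrightarrow>
        f i = quad (of_int A / of_int d) (of_int B / of_int d) (of_int C / of_int d) (of_int D / of_int d) \<and> \<Phi> A B C D"
      using coords f(1) by blast
    then obtain A B C D where ABCD: "\<And>i. i < 5 \<Longrightarrow>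
        f i = quad (of_int (A i) / of_int d) (of_int (B i) / of_int d) (of_int (C i) / of_int d) (of_int (D i) / of_int d)"
      "\<And>i. i < 5 \<Longrightarrow> \<Phi> (A i) (B i) (C i) (D i)" by metis
    have "(\<Sum>i<5. (f i)\<^sup>2) = (\<Sum>i<5. (quad (of_int (A i) / of_int d) (of_int (B i) / of_int d) (of_int (C i) / of_int d) (of_int (D i) / of_int d))\<^sup>2)"
      using ABCD(1) by (intro sum.cong) auto
    then have "(\<Sum>i<5. (quad (of_int (A i) / of_int d) (of_int (B i) / of_int d) (of_int (C i) / of_int d) (of_int (D i) / of_int d))\<^sup>2)
      = quad (of_int ka / of_int (d * d)) (of_int kb / of_int (d * d)) (of_int kc / of_int (d * d)) (of_int kd / of_int (d * d))"
      using f(2) eq by simp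
    from nosol[OF ABCD(2) five_squares_equations[OF d this]] show False by blast
  qed
qed

lemma half_sum_in_ring_of_integers:
  fixes k :: int
  assumes "4 dvd c * (a - b)" "even (c * (a + b))" and "(e1, e2) \<in> {(1, 1), (1, -1), (-1, 1 :: real)}"
  shows "quad (of_int k) (e1 / 2) (e2 / 2) 0 \<in> ring_of_integers span"
proof (rule ring_of_integersI[OF _ _ _ _ refl])
  have "quad (of_int k) (e1 / 2) (e2 / 2) 0 = of_int k + (e1 * P + e2 * Q) / 2"
    by (simp add: quad_def add_divide_distrib)
  then show "algebraic_int (quad (of_int k) (e1 / 2) (e2 / 2) 0)"
    using algebraic_int_half_sum[OF assms] by simp
qed (use assms in auto)

lemma pythagoras_type_B2:
  assumes c: "c mod 4 = 2" and ab: "(a * b) mod 4 = 3"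
    and ge: "b * c \<ge> 10" "a * c \<ge> 10" "a * b \<ge> 10"
  shows "pythagoras_number (ring_of_integers span) \<ge> 6"
proof -
  have odd: "odd a" "odd b" using odd_if_mod_4[of "a * b"] ab by auto
  have ev: "even c" "even (a - b)" using c odd by presburger+
  have mod2: "(x * c) mod 4 = 2" if "odd x" for x
  proof -
    obtain k where k: "x = 2 * k + 1" using \<open>odd x\<close> by (elim oddE)
    obtain j where j: "c = 2 * j" using ev by (elim evenE)
    have "x * c = 4 * (k * j) + c" unfolding k by (simp add: j algebra_simps)
    then show ?thesis using c by simp
  qed
  have h: "4 dvd c * (a - b)" using mult_dvd_mono[OF ev] by simp
  have ev': "even (c * (a + b))" using ev by simp
  show ?thesis
  proof (rule pythagoras_number_ge_6_if_no_solution[where d = 2 and ka = "32 + 2 * (b * c) + 2 * (a * c)" and kb = 4 and kc = "-4" and kd = 0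
        and x = "quad 0 (1 / 2) (1 / 2) 0" and y = "quad 1 (1 / 2) (- 1 / 2) 0"
        and \<Phi> = "\<lambda>A B C D. even A \<and> even D \<and> even (B + C)"])
    show "quad 0 (1 / 2) (1 / 2) 0 \<in> ring_of_integers span"
      using half_sum_in_ring_of_integers[OF h ev', of 1 1 0] by simp
    show "quad 1 (1 / 2) (- 1 / 2) 0 \<in> ring_of_integers span"
      using half_sum_in_ring_of_integers[OF h ev', of 1 "-1" 1] by simp
    show "7 + (quad 0 (1 / 2) (1 / 2) 0)\<^sup>2 + (quad 1 (1 / 2) (- 1 / 2) 0)\<^sup>2 =
      quad (of_int (32 + 2 * (b * c) + 2 * (a * c)) / of_int (2 * 2)) (of_int 4 / of_int (2 * 2)) (of_int (- 4) / of_int (2 * 2)) (of_int 0 / of_int (2 * 2))"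
      unfolding power2_eq_square quad_mult by (simp add: quad_def field_simps)
    show "\<exists>A B C D :: int. z = quad (of_int A / of_int 2) (of_int B / of_int 2) (of_int C / of_int 2) (of_int D / of_int 2)
        \<and> even A \<and> even D \<and> even (B + C)" if "z \<in> ring_of_integers span" for z
      by (rule type_B2_coordinates[OF that mod2[OF odd(2)] mod2[OF odd(1)] ab])
    fix A B C D :: "nat \<Rightarrow> int"
    assume par: "\<And>i. i < 5 \<Longrightarrow> even (A i) \<and> even (D i) \<and> even (B i + C i)"
      and e: "dot A A + b * c * dot B B + a * c * dot C C + a * b * dot D D = 32 + 2 * (b * c) + 2 * (a * c)"
      "2 * (dot A B + a * dot C D) = 4" "2 * (dot A C + b * dot B D) = - 4" "2 * (dot A D + c * dot B C) = 0"
    \<comment> \<open>In type B2 the coordinates at 1 and \<open>R\<close> are even; dividing them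
      by 2 produces the coefficients 4 in the system.\<close>
    define A' D' where "A' i = A i div 2" and "D' i = D i div 2" for i
    have A': "A i = 2 * A' i" and D': "D i = 2 * D' i" if "i < 5" for i using par[OF that] by (auto simp: A'_def D'_def)
    note dd = dot_double[of A A', OF A'] dot_double[of D D', OF D']
    obtain k where k: "c = 2 * k" using ev by (elim evenE)
    have "odd k" using c k by presburger
    show False
    proof (rule no_solution_type_B2[where A = A' and B = B and C = C and D = D' and m = "b * c" and n = "a * c" and s = "a * b" and a = a and b = b and c = c and k = k])
      show "even (B i + C i)" if "i < 5" for i using par[OF that] by blast
      show "4 * dot A' A' + b * c * dot B B + a * c * dot C C + 4 * (a * b) * dot D' D' = 32 + 2 * (b * c) + 2 * (a * c)"
        using e(1) by (simp add: dd)
      show "dot A' B + a * dot C D' = 1" using e(2) by (simp add: dd)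
      show "dot A' C + b * dot B D' = - 1" using e(3) by (simp add: dd)
      show "4 * dot A' D' + c * dot B C = 0" using e(4) by (simp add: dd)
    qed (use ge k \<open>odd k\<close> in auto)
  qed simp
qed

lemma pythagoras_type_B1:
  assumes ab: "a > b" "odd b" "4 dvd a - b" and c: "\<not> 4 dvd c - a"
    and ge: "b * c \<ge> 10" "a * c \<ge> 10" "a * b \<ge> 10" and ne: "a * b \<noteq> 13"
  shows "pythagoras_number (ring_of_integers span) \<ge> 6"
proof -
  obtain k where k: "a = b + 4 * k" using ab(3) by (metis dvdE add.commute diff_add_cancel)
  have a4: "a \<ge> b + 4" using k ab(1) by auto
  have "4 dvd b * b - 1" using odd_square_mod_8[OF ab(2)] dvd_trans[of 4 8 "b * b - 1"] by simp
  then obtain l where l: "b * b = 1 + 4 * l" by (metis dvdE add.commute diff_add_cancel)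
  have "a * b = 4 * (k * b + l) + 1" using l by (simp add: k algebra_simps)
  then have r: "(a * b) mod 4 = 1" by presburger
  have q: "(a * c) mod 4 = (b * c) mod 4"
  proof -
    have "a * c = b * c + 4 * (k * c)" by (simp add: k algebra_simps)
    then show ?thesis by simp
  qed
  have c4: "\<not> 4 dvd c"
  proof
    assume "4 dvd c"
    then have "2\<^sup>2 dvd b * c" by simp
    then have "(2::int) dvd 1" by (rule squarefreeD[OF sqfree(1)])
    then show False by simp
  qed
  have p: "(b * c) mod 4 = 2 \<or> (b * c) mod 4 = 3"
  proof -
    have "b mod 4 = 1 \<or> b mod 4 = 3" using ab(2) by presburger
    moreover have "\<not> 4 dvd c - b" using c k by (simp add: algebra_simps) presburger
    then have "c mod 4 \<noteq> b mod 4" by presburger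
    moreover have "c mod 4 = 1 \<or> c mod 4 = 2 \<or> c mod 4 = 3" using c4 by presburger
    moreover have "(b * c) mod 4 = ((b mod 4) * (c mod 4)) mod 4" by (simp add: mod_mult_eq)
    ultimately show ?thesis by auto
  qed
  have coords: "\<exists>A B C D :: int. z = quad (of_int A / of_int 2) (of_int B / of_int 2) (of_int C / of_int 2) (of_int D / of_int 2)
        \<and> even (A + D) \<and> even (B + C)" if "z \<in> ring_of_integers span" for z
    by (rule type_B1_coordinates[OF that p q r])
  have h: "4 dvd c * (a - b)" using ab(3) by simp
  have ev: "even (c * (a + b))" using k by simp
  have half: "quad (1 / 2) 0 0 (1 / 2) \<in> ring_of_integers span"
  proof (rule ring_of_integersI[OF _ _ _ _ refl])
    have "4 dvd a * b - 1 * 1" using r by presburger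
    from algebraic_int_half[OF this mults(3)] show "algebraic_int (quad (1 / 2) 0 0 (1 / 2))"
      by (simp add: quad_def add_divide_distrib)
  qed auto
  note main = pythagoras_number_ge_6_if_no_solution[where d = 2 and \<Phi> = "\<lambda>A B C D. even (A + D) \<and> even (B + C)", OF _ _ _ _ coords]
  show ?thesis
  proof (cases "b = 1")
    case True
    have "a mod 4 = 1" using r True by simp
    \<comment> \<open>Between 10 and 16 only 13 is 1 modulo 4.\<close>
    then have a17: "a \<ge> 17" using ge(3) ne True by simp presburger
    have y: "quad 1 1 0 0 \<in> ring_of_integers span"
    proof (rule ring_of_integersI[OF _ _ _ _ refl])
      have "(2 * P) * (2 * P) = of_int (4 * (b * c))" using mults(1) by simp
      from algebraic_int_half[OF _ this, of 2] have "algebraic_int ((2 + 2 * P) / 2)" by simp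
      also have "(2 + 2 * P) / 2 = quad 1 1 0 0" by (simp add: quad_def)
      finally show "algebraic_int (quad 1 1 0 0)" .
    qed auto
    show ?thesis
    proof (rule main[where ka = "33 + a * b + 4 * (b * c)" and kb = 8 and kc = 0 and kd = 2, OF _ half y])
      show "7 + (quad (1 / 2) 0 0 (1 / 2))\<^sup>2 + (quad 1 1 0 0)\<^sup>2 =
        quad (of_int (33 + a * b + 4 * (b * c)) / of_int (2 * 2)) (of_int 8 / of_int (2 * 2)) (of_int 0 / of_int (2 * 2)) (of_int 2 / of_int (2 * 2))"
        unfolding power2_eq_square quad_mult by (simp add: quad_def field_simps)
      fix A B C D :: "nat \<Rightarrow> int"
      assume "\<And>i. i < 5 \<Longrightarrow> even (A i + D i) \<and> even (B i + C i)"
        and "dot A A + b * c * dot B B + a * c * dot C C + a * b * dot D D = 33 + a * b + 4 * (b * c)"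
        "2 * (dot A B + a * dot C D) = 8" "2 * (dot A C + b * dot B D) = 0" "2 * (dot A D + c * dot B C) = 2"
      then show False using a17 ge(1) True
        by (intro no_solution_type_B1_unit[of a c A D B C]) auto
    qed auto
  next
    case False
    then have b3: "b \<ge> 3" using ab(2) pos by presburger
    have "c \<noteq> b"
    proof
      assume "c = b"
      then have "b\<^sup>2 dvd b * c" by (simp add: power2_eq_square)
      then have "b dvd 1" by (rule squarefreeD[OF sqfree(1)])
      then show False using b3 by simp
    qed
    then consider "c > b" | "c < b" by linarith
    then show ?thesis
    proof cases
      case 1
      have y: "quad 1 (1 / 2) (1 / 2) 0 \<in> ring_of_integers span"
        using half_sum_in_ring_of_integers[OF h ev, of 1 1 1] by simp
      show ?thesis
      proof (rule main[where ka = "33 + a * b + b * c + a * c" and kb = 4 and kc = 4 and kd = "2 + 2 * c", OF _ half y])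
        show "7 + (quad (1 / 2) 0 0 (1 / 2))\<^sup>2 + (quad 1 (1 / 2) (1 / 2) 0)\<^sup>2 =
          quad (of_int (33 + a * b + b * c + a * c) / of_int (2 * 2)) (of_int 4 / of_int (2 * 2)) (of_int 4 / of_int (2 * 2)) (of_int (2 + 2 * c) / of_int (2 * 2))"
          unfolding power2_eq_square quad_mult by (simp add: quad_def field_simps)
        fix A B C D :: "nat \<Rightarrow> int"
        assume "\<And>i. i < 5 \<Longrightarrow> even (A i + D i) \<and> even (B i + C i)"
          and "dot A A + b * c * dot B B + a * c * dot C C + a * b * dot D D = 33 + a * b + b * c + a * c"
          "2 * (dot A B + a * dot C D) = 4" "2 * (dot A C + b * dot B D) = 4" "2 * (dot A D + c * dot B C) = 2 + 2 * c"
        then show False using a4 b3 1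
          by (intro no_solution_type_B1_large[of b a c "b * c" "a * c" "a * b" A D B C]) auto
      qed auto
    next
      case 2
      have b5: "b \<ge> 5"
      proof (rule ccontr)
        assume "\<not> b \<ge> 5"
        then have "b = 3" using b3 ab(2) by presburger
        then show False using ge(1) 2 by simp
      qed
      \<comment> \<open>Since \<open>a \<ge> b + 4 \<ge> 9\<close>, only 9 * 5 = 45 could fail, and
        it is not square-free.\<close>
      have s: "a * b > 48"
      proof (cases "a \<ge> 10")
        case True
        then have "a * b \<ge> 10 * 5" using b5 by (intro mult_mono) auto
        then show ?thesis by simp
      next
        case False
        then have "a = 9" using a4 b5 by simp
        then have "3\<^sup>2 dvd a * b" by simp
        then have "(3::int) dvd 1" by (rule squarefreeD[OF sqfree(3)])
        then show ?thesis by simp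
      qed
      have x: "quad 1 (1 / 2) (1 / 2) 0 \<in> ring_of_integers span"
        using half_sum_in_ring_of_integers[OF h ev, of 1 1 1] by simp
      have y: "quad 2 (- 1 / 2) (1 / 2) 0 \<in> ring_of_integers span"
        using half_sum_in_ring_of_integers[OF h ev, of "-1" 1 2] by simp
      show ?thesis
      proof (rule main[where ka = "48 + 2 * (b * c) + 2 * (a * c)" and kb = "-4" and kc = 12 and kd = 0, OF _ x y])
        show "7 + (quad 1 (1 / 2) (1 / 2) 0)\<^sup>2 + (quad 2 (- 1 / 2) (1 / 2) 0)\<^sup>2 =
          quad (of_int (48 + 2 * (b * c) + 2 * (a * c)) / of_int (2 * 2)) (of_int (- 4) / of_int (2 * 2)) (of_int 12 / of_int (2 * 2)) (of_int 0 / of_int (2 * 2))"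
          unfolding power2_eq_square quad_mult by (simp add: quad_def field_simps)
        fix A B C D :: "nat \<Rightarrow> int"
        assume "\<And>i. i < 5 \<Longrightarrow> even (A i + D i) \<and> even (B i + C i)"
          and "dot A A + b * c * dot B B + a * c * dot C C + a * b * dot D D = 48 + 2 * (b * c) + 2 * (a * c)"
          "2 * (dot A B + a * dot C D) = - 4" "2 * (dot A C + b * dot B D) = 12" "2 * (dot A D + c * dot B C) = 0"
        then show False using a4 b5 2 pos ge(1) s
          by (intro no_solution_type_B1_small[of c b a "b * c" "a * c" "a * b" A D B C]) auto
      qed auto
    qed
  qed
qed

lemma pythagoras_type_A:
  assumes ord: "c < b" "b < a" and odd: "odd c" and cong: "4 dvd b - c" "4 dvd a - c"
    and ge: "b * c \<ge> 10" and ne: "b * c \<noteq> 13"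
  shows "pythagoras_number (ring_of_integers span) \<ge> 6"
proof -
  obtain v w where vw: "b = c + 4 * v" "a = c + 4 * w"
    using cong by (metis dvdE add.commute diff_add_cancel)
  have b4: "b \<ge> c + 4" and a4: "a \<ge> b + 4" using vw ord by auto
  have "4 dvd c * c - 1" using odd_square_mod_8[OF odd] dvd_trans[of 4 8 "c * c - 1"] by simp
  then obtain l where l: "c * c = 1 + 4 * l" by (metis dvdE add.commute diff_add_cancel)
  have "b * c = 1 + 4 * (l + v * c)" "a * c = 1 + 4 * (l + w * c)"
    "a * b = 1 + 4 * (l + v * c + w * c + 4 * v * w)"
    using l by (simp_all add: vw algebra_simps)
  then have mods: "(b * c) mod 4 = 1" "(a * c) mod 4 = 1" "(a * b) mod 4 = 1" by presburger+
  \<comment> \<open>For \<open>c = 1\<close> the radicand 17 is possible and violates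
    \<open>2 * (b * c) > 29 + t * t\<close> if \<open>t = 3\<close>. For \<open>c \<ge> 3\<close>
    the value 3 keeps the prescribed values 12 and 4 apart when odd coordinates are
    excluded.\<close>
  define t :: int where "t = (if c = 1 then 1 else 3)"
  have small: "b \<ge> 17" if "c = 1"
  proof -
    have "b mod 4 = 1" "b \<ge> 10" "b \<noteq> 13" using mods(1) ge ne that by auto
    then show ?thesis by presburger
  qed
  have c3: "c \<ge> 3" if "c \<noteq> 1" using that odd pos by presburger
  have bc: "2 * (b * c) > 29 + t * t"
  proof (cases "c = 1")
    case False
    then have "b * c \<ge> 7 * 3" using b4 c3 by (intro mult_mono) auto
    then show ?thesis using False by (simp add: t_def)
  qed (use small in \<open>simp add: t_def\<close>)
  have ac: "a * c \<ge> b * c" using ord pos by (intro mult_right_mono) auto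
  have rr: "a * b > 29 + t * t"
  proof -
    have "a * b \<ge> 11 * 7" if "c \<noteq> 1" using a4 b4 c3[OF that] by (intro mult_mono) auto
    moreover have "a * b \<ge> 21 * 17" if "c = 1" using a4 small[OF that] by (intro mult_mono) auto
    ultimately show ?thesis by (auto simp: t_def)
  qed
  have half: "4 dvd n - k * k" if "n mod 4 = 1" "odd k" for n k :: int
  proof -
    have "4 dvd k * k - 1" using odd_square_mod_8[OF that(2)] dvd_trans[of 4 8 "k * k - 1"] by simp
    moreover have "4 dvd n - 1" using that(1) by presburger
    ultimately have "4 dvd (n - 1) - (k * k - 1)" by (rule_tac dvd_diff)
    then show ?thesis by simp
  qed
  have "odd t" by (simp add: t_def)
  show ?thesis
  proof (rule pythagoras_number_ge_6_if_no_solution[where d = 4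
        and ka = "116 + 4 * (t * t) + 4 * (b * c) + 4 * (a * c)" and kb = "8 * t" and kc = 8 and kd = 0
        and x = "quad (of_int t / 2) (1 / 2) 0 0" and y = "quad (1 / 2) 0 (1 / 2) 0"
        and \<Phi> = "\<lambda>A B C D. even (A + B) \<and> even (A + C) \<and> even (A + D) \<and> (even A \<longrightarrow> 4 dvd A + B + C + D)"])
    show "quad (of_int t / 2) (1 / 2) 0 0 \<in> ring_of_integers span"
      using algebraic_int_half[OF half[OF mods(1) \<open>odd t\<close>] mults(1)]
      by (intro ring_of_integersI[OF _ _ _ _ refl]) (auto simp: quad_def add_divide_distrib)
    show "quad (1 / 2) 0 (1 / 2) 0 \<in> ring_of_integers span"
      using algebraic_int_half[OF half[OF mods(2), of 1] mults(2)]
      by (intro ring_of_integersI[OF _ _ _ _ refl]) (auto simp: quad_def add_divide_distrib)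
    show "7 + (quad (of_int t / 2) (1 / 2) 0 0)\<^sup>2 + (quad (1 / 2) 0 (1 / 2) 0)\<^sup>2 =
      quad (of_int (116 + 4 * (t * t) + 4 * (b * c) + 4 * (a * c)) / of_int (4 * 4)) (of_int (8 * t) / of_int (4 * 4))
        (of_int 8 / of_int (4 * 4)) (of_int 0 / of_int (4 * 4))"
      unfolding power2_eq_square quad_mult by (simp add: quad_def field_simps)
    show "\<exists>A B C D :: int. z = quad (of_int A / of_int 4) (of_int B / of_int 4) (of_int C / of_int 4) (of_int D / of_int 4)
        \<and> even (A + B) \<and> even (A + C) \<and> even (A + D) \<and> (even A \<longrightarrow> 4 dvd A + B + C + D)"
      if "z \<in> ring_of_integers span" for z
      by (rule type_A_coordinates[OF that mods])
    fix A B C D :: "nat \<Rightarrow> int"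
    assume par: "\<And>i. i < 5 \<Longrightarrow> even (A i + B i) \<and> even (A i + C i) \<and> even (A i + D i) \<and>
        (even (A i) \<longrightarrow> 4 dvd A i + B i + C i + D i)"
      and e: "dot A A + b * c * dot B B + a * c * dot C C + a * b * dot D D = 116 + 4 * (t * t) + 4 * (b * c) + 4 * (a * c)"
      "2 * (dot A B + a * dot C D) = 8 * t" "2 * (dot A C + b * dot B D) = 8" "2 * (dot A D + c * dot B C) = 0"
    have ev: "even (A i)" if i: "i < 5" for i
    proof (cases "c = 1")
      case True
      \<comment> \<open>For \<open>c = 1\<close> the right-hand side is
        \<open>120 + 4 * a + 4 * b\<close>, less than \<open>a * b\<close>. A vanishing
        \<open>D\<close> makes all other coordinates even by parity.\<close>
      have "dot D D = 0"
      proof (rule ccontr)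
        assume "dot D D \<noteq> 0"
        then have "dot D D \<ge> 1" using dot_self_nonneg[of D] by simp
        then have "a * b * dot D D \<ge> a * b * 1" using pos by (intro mult_left_mono) auto
        moreover have "b * c * dot B B \<ge> 0" "a * c * dot C C \<ge> 0"
          using pos dot_self_nonneg[of B] dot_self_nonneg[of C] by auto
        moreover have "(a - 4) * (b - 4) \<ge> 17 * 13" using a4 small[OF True] by (intro mult_mono) auto
        then have "a * b \<ge> 205 + 4 * a + 4 * b" by (simp add: algebra_simps)
        ultimately show False using e(1) True dot_self_nonneg[of A] by (simp add: t_def)
      qed
      then have "D i = 0" using i by (rule dot_self_eq_0D)
      then show ?thesis using par[OF i] by auto
    next
      case False
      show ?thesis
      proof (rule type_A_solution_even[where A = A and B = B and C = C and D = D and a = a and b = b and c = c])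
        show "dot A A + b * c * dot B B + a * c * dot C C + a * b * dot D D = 152 + 4 * (b * c) + 4 * (a * c)"
          using e(1) False by (simp add: t_def)
        show "dot A B + a * dot C D = 12" using e(2) False by (simp add: t_def)
        show "dot A C + b * dot B D = 4" "dot A D + c * dot B C = 0" using e(3,4) by simp_all
      qed (use c3[OF False] b4 a4 odd cong par i in auto)
    qed
    define A' B' C' D' where "A' i = A i div 2" and "B' i = B i div 2" and "C' i = C i div 2" and "D' i = D i div 2" for i
    have d: "A i = 2 * A' i" "B i = 2 * B' i" "C i = 2 * C' i" "D i = 2 * D' i" if "i < 5" for i
      using par[OF that] ev[OF that] by (auto simp: A'_def B'_def C'_def D'_def)
    note dd = dot_double[of A A', OF d(1)] dot_double[of B B', OF d(2)] dot_double[of C C', OF d(3)] dot_double[of D D', OF d(4)]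
    show False
    proof (rule no_solution_type_A_even[where A = A' and B = B' and C = C' and D = D' and a = a and b = b and c = c and t = t])
      show "even (A' i + B' i + C' i + D' i)" if i: "i < 5" for i
      proof -
        have "4 dvd 2 * A' i + 2 * B' i + 2 * C' i + 2 * D' i" using par[OF i] ev[OF i] d[OF i] by simp
        then show ?thesis by presburger
      qed
      show "dot A' A' + b * c * dot B' B' + a * c * dot C' C' + a * b * dot D' D' = 29 + t * t + b * c + a * c"
        using e(1) by (simp add: dd)
      show "dot A' B' + a * dot C' D' = t" using e(2) by (simp add: dd)
      show "dot A' C' + b * dot B' D' = 1" using e(3) by (simp add: dd)
      show "dot A' D' + c * dot B' C' = 0" using e(4) by (simp add: dd)
      show "a > t" using a4 b4 pos c3 by (auto simp: t_def)
      show "2 * (a * c) > 29 + t * t" using bc ac by simp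
    qed (use \<open>odd t\<close> b4 pos bc rr in \<open>auto simp: t_def\<close>)
  qed simp
qed

end

section \<open>The lower bound\<close>

text \<open>The exchange swaps \<open>P\<close> and \<open>Q\<close> and fixes \<open>R\<close>, so
  the field is unchanged. Transpositions of this kind bring the parameters into the order that each
  type requires.\<close>

lemma biquadratic_swap12:
  assumes "biquadratic a b c"
  shows "biquadratic b a c" "biquadratic.span b a c = biquadratic.span a b c"
proof -
  interpret A: biquadratic a b c by (rule assms)
  show "biquadratic b a c"
    using A.pos A.sqfree A.gt1 by unfold_locales (simp_all add: mult.commute)
  then interpret B: biquadratic b a c .
  have "B.quad u v w z = A.quad u w v z" for u v w z
    by (simp add: A.quad_def B.quad_def A.P_def A.Q_def A.R_def B.P_def B.Q_def B.R_def mult.commute)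
  then show "B.span = A.span" unfolding A.span_def B.span_def by (auto; blast)
qed

lemma biquadratic_swap13:
  assumes "biquadratic a b c"
  shows "biquadratic c b a" "biquadratic.span c b a = biquadratic.span a b c"
proof -
  interpret A: biquadratic a b c by (rule assms)
  show "biquadratic c b a"
    using A.pos A.sqfree A.gt1 by unfold_locales (simp_all add: mult.commute)
  then interpret B: biquadratic c b a .
  have "B.quad u v w z = A.quad u z w v" for u v w z
    by (simp add: A.quad_def B.quad_def A.P_def A.Q_def A.R_def B.P_def B.Q_def B.R_def mult.commute)
  then show "B.span = A.span" unfolding A.span_def B.span_def by (auto; blast)
qed

text \<open>The consequences of the excluded square roots, stated for all three radicands so as to
  be invariant under permutation.\<close>

definition admissible :: "int \<Rightarrow> int \<Rightarrow> int \<Rightarrow> bool" where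
  "admissible a b c \<longleftrightarrow> biquadratic a b c \<and> b * c \<ge> 10 \<and> a * c \<ge> 10 \<and> a * b \<ge> 10
    \<and> b * c \<noteq> 13 \<and> a * c \<noteq> 13 \<and> a * b \<noteq> 13"

abbreviation biquadratic_pythagoras :: "int \<Rightarrow> int \<Rightarrow> int \<Rightarrow> enat" where
  "biquadratic_pythagoras a b c \<equiv> pythagoras_number (ring_of_integers (biquadratic.span a b c))"

lemma admissible_swap12:
  assumes "admissible a b c"
  shows "admissible b a c" "biquadratic_pythagoras b a c = biquadratic_pythagoras a b c"
  using assms biquadratic_swap12[of a b c] by (auto simp: admissible_def mult.commute)

lemma admissible_swap13:
  assumes "admissible a b c"
  shows "admissible c b a" "biquadratic_pythagoras c b a = biquadratic_pythagoras a b c"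
  using assms biquadratic_swap13[of a b c] by (auto simp: admissible_def mult.commute)

lemma admissible_swap23:
  assumes "admissible a b c"
  shows "admissible a c b" "biquadratic_pythagoras a c b = biquadratic_pythagoras a b c"
proof -
  note 1 = admissible_swap12[OF assms]
  note 2 = admissible_swap13[OF 1(1)]
  note 3 = admissible_swap12[OF 2(1)]
  show "admissible a c b" "biquadratic_pythagoras a c b = biquadratic_pythagoras a b c"
    using 1 2 3 by simp_all
qed

lemma admissible_neq:
  assumes "admissible a b c"
  shows "a \<noteq> b" "a \<noteq> c" "b \<noteq> c"
proof -
  interpret biquadratic a b c using assms by (simp add: admissible_def)
  have *: "x \<noteq> y" if "squarefree (x * y)" "x * y > 1" "x > 0" for x y :: int
  proof
    assume "x = y"
    then have "x\<^sup>2 dvd x * y" by (simp add: power2_eq_square)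
    then have "x dvd 1" by (rule squarefreeD[OF that(1)])
    then have "x = 1" using that(3) by simp
    then show False using that(2) \<open>x = y\<close> by simp
  qed
  show "a \<noteq> b" "a \<noteq> c" "b \<noteq> c" using * sqfree gt1 pos by blast+
qed

lemma admissible_even:
  assumes "admissible a b c" "even c"
  shows "odd a" "odd b" "c mod 4 = 2"
proof -
  interpret biquadratic a b c using assms by (simp add: admissible_def)
  have *: "\<not> 4 dvd x" if "squarefree x" for x :: int
  proof
    assume "4 dvd x"
    then have "2\<^sup>2 dvd x" by simp
    then have "(2::int) dvd 1" by (rule squarefreeD[OF that])
    then show False by simp
  qed
  show "odd a" using *[OF sqfree(2)] mult_dvd_mono[of 2 a 2 c] assms(2) by auto
  show "odd b" using *[OF sqfree(1)] mult_dvd_mono[of 2 b 2 c] assms(2) by auto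
  have "\<not> 4 dvd c" using *[OF sqfree(1)] by auto
  then show "c mod 4 = 2" using assms(2) by presburger
qed

section \<open>Case distinction by residues modulo 4\<close>

lemma pythagoras_congruent_pair:
  assumes adm: "admissible a b c" and "odd b" "4 dvd a - b" "\<not> 4 dvd c - a"
  shows "biquadratic_pythagoras a b c \<ge> 6"
proof (cases "a > b")
  case True
  interpret biquadratic a b c using adm by (simp add: admissible_def)
  show ?thesis using pythagoras_type_B1[OF True] assms by (simp add: admissible_def)
next
  case False
  then have "b > a" using admissible_neq(1)[OF adm] by simp
  note sw = admissible_swap12[OF adm]
  interpret biquadratic b a c using sw(1) by (simp add: admissible_def)
  have "odd a" "4 dvd b - a" "\<not> 4 dvd c - b" using assms by presburger+
  then show ?thesis using pythagoras_type_B1[OF \<open>b > a\<close>] sw by (simp add: admissible_def)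
qed

lemma pythagoras_even:
  assumes adm: "admissible a b c" and "even c"
  shows "biquadratic_pythagoras a b c \<ge> 6"
proof -
  note ev = admissible_even[OF assms]
  interpret biquadratic a b c using adm by (simp add: admissible_def)
  show ?thesis
  proof (cases "4 dvd a - b")
    case True
    have "\<not> 4 dvd c - a" using ev by presburger
    then show ?thesis using pythagoras_congruent_pair[OF adm ev(2) True] by simp
  next
    case False
    have "a mod 4 = 1 \<and> b mod 4 = 3 \<or> a mod 4 = 3 \<and> b mod 4 = 1" using ev False by presburger
    moreover have "(a * b) mod 4 = ((a mod 4) * (b mod 4)) mod 4" by (simp add: mod_mult_eq)
    ultimately have "(a * b) mod 4 = 3" by auto
    then show ?thesis using pythagoras_type_B2[OF ev(3)] adm by (simp add: admissible_def)
  qed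
qed

lemma pythagoras_all_congruent:
  assumes adm: "admissible a b c" and "odd c" "4 dvd b - c" "4 dvd a - c"
  shows "biquadratic_pythagoras a b c \<ge> 6"
proof -
  have *: "biquadratic_pythagoras a b c \<ge> 6"
    if "admissible a b c" "odd c" "4 dvd b - c" "4 dvd a - c" "c < b" "b < a" for a b c
  proof -
    interpret biquadratic a b c using that(1) by (simp add: admissible_def)
    show ?thesis using pythagoras_type_A that by (simp add: admissible_def)
  qed
  have **: "biquadratic_pythagoras a b c \<ge> 6"
    if adm: "admissible a b c" and h: "odd c" "4 dvd b - c" "4 dvd a - c" "c < b" for a b c
  proof -
    note ne = admissible_neq[OF adm] and s12 = admissible_swap12[OF adm]
    consider "b < a" | "a < b" "c < a" | "a < c" using ne h(4) by linarith
    then show ?thesis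
    proof cases
      case 1
      then show ?thesis using *[OF adm h] by simp
    next
      case 2
      then show ?thesis using *[OF s12(1) h(1,3,2)] s12(2) by simp
    next
      case 3
      have "odd a" "4 dvd c - a" "4 dvd b - a" using h by presburger+
      note s13 = admissible_swap13[OF adm]
      note s13' = admissible_swap12[OF s13(1)]
      have "biquadratic_pythagoras b c a \<ge> 6"
        using *[OF s13'(1) \<open>odd a\<close> \<open>4 dvd c - a\<close> \<open>4 dvd b - a\<close> 3 h(4)] .
      then show ?thesis using s13'(2) s13(2) by simp
    qed
  qed
  show ?thesis
  proof (cases "c < b")
    case True
    then show ?thesis using **[OF assms] by simp
  next
    case False
    then have "b < c" using admissible_neq(3)[OF adm] by simp
    have "odd b" "4 dvd c - b" "4 dvd a - b" using assms by presburger+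
    then show ?thesis using **[OF admissible_swap23(1)[OF adm]] \<open>b < c\<close> admissible_swap23(2)[OF adm] by simp
  qed
qed

lemma biquadratic_pythagoras_ge_6:
  assumes adm: "admissible a b c"
  shows "biquadratic_pythagoras a b c \<ge> 6"
proof -
  note s13 = admissible_swap13[OF adm] and s23 = admissible_swap23[OF adm]
  consider "even c" | "even a" | "even b" | "odd a" "odd b" "odd c" by blast
  then show ?thesis
  proof cases
    case 1
    then show ?thesis by (rule pythagoras_even[OF adm])
  next
    case 2
    then show ?thesis using pythagoras_even[OF s13(1)] s13(2) by simp
  next
    case 3
    then show ?thesis using pythagoras_even[OF s23(1)] s23(2) by simp
  next
    case 4
    \<comment> \<open>Among three odd numbers two agree modulo 4, so either all three agree or
      exactly one pair does.\<close>
    have "4 dvd b - c \<and> 4 dvd a - c \<or> 4 dvd a - b \<and> \<not> 4 dvd c - a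
        \<or> 4 dvd a - c \<and> \<not> 4 dvd b - a \<or> 4 dvd c - b \<and> \<not> 4 dvd a - c"
      using 4 by presburger
    then consider "4 dvd b - c" "4 dvd a - c" | "4 dvd a - b" "\<not> 4 dvd c - a"
      | "4 dvd a - c" "\<not> 4 dvd b - a" | "4 dvd c - b" "\<not> 4 dvd a - c" by blast
    then show ?thesis
    proof cases
      case 1
      then show ?thesis using pythagoras_all_congruent[OF adm 4(3)] by simp
    next
      case 2
      then show ?thesis using pythagoras_congruent_pair[OF adm 4(2)] by simp
    next
      case 3
      then show ?thesis using pythagoras_congruent_pair[OF s23(1) 4(3)] s23(2) by simp
    next
      case 4
      then show ?thesis using pythagoras_congruent_pair[OF s13(1) \<open>odd b\<close>] s13(2) by simp
    qed
  qed
qed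

lemma squarefree_ge_10:
  fixes n :: int
  assumes "squarefree n" "n > 1" "n \<notin> {2, 3, 5, 6, 7}"
  shows "n \<ge> 10"
proof (rule ccontr)
  assume "\<not> n \<ge> 10"
  then have "n \<in> {4, 8, 9}" using assms(2,3) by auto
  then have "2\<^sup>2 dvd n \<or> 3\<^sup>2 dvd n" by auto
  then have "(2::int) dvd 1 \<or> (3::int) dvd 1" using squarefreeD[OF assms(1)] by blast
  then show False by auto
qed

theorem theorem1p1:
  fixes p q :: int and K :: "real set"
  assumes "p > 1" and "q > 1" and "p \<noteq> q"
    and "squarefree p" and "squarefree q"
    and "K = rat_adjoin {sqrt (real_of_int p), sqrt (real_of_int q)}"
    and "sqrt 2 \<notin> K" and "sqrt 3 \<notin> K" and "sqrt 5 \<notin> K"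
    and "sqrt 6 \<notin> K" and "sqrt 7 \<notin> K" and "sqrt 13 \<notin> K"
  shows "pythagoras_number (ring_of_integers K) \<ge> 6"
proof -
  \<comment> \<open>Splitting off the greatest common divisor exhibits the third radicand: the
    square root of \<open>a * b\<close> is that of \<open>p * q\<close> divided by \<open>c\<close>.
    It lies in \<open>K\<close> too, so the exclusions apply to it.\<close>
  define c where "c = gcd p q"
  obtain a b where ab: "q = a * c" "p = b * c" unfolding c_def by (metis gcd_dvd1 gcd_dvd2 dvdE mult.commute)
  have c: "c > 0" using assms(1) by (simp add: c_def)
  have pos: "a > 0" "b > 0" 
    using zero_less_mult_pos2[of a c] zero_less_mult_pos2[of b c] ab assms(1,2) c by auto
  have "coprime a b"
  proof -
    have "\<bar>c\<bar> * gcd b a = gcd (c * b) (c * a)" by (rule gcd_mult_distrib_int)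
    also have "\<dots> = gcd p q" by (simp only: ab mult.commute)
    also have "\<dots> = c" by (simp only: c_def)
    finally have "gcd b a = 1" using c by simp
    then show ?thesis by (simp add: coprime_iff_gcd_eq_1 gcd.commute)
  qed
  have "squarefree a" "squarefree b"
    using assms(4,5) unfolding ab by (auto dest: squarefree_multD)
  then have sq: "squarefree (a * b)" using \<open>coprime a b\<close> by (simp add: squarefree_mult_coprime)
  have "a * b > 1"
  proof (rule ccontr)
    assume "\<not> a * b > 1"
    then have "a * b = 1" using pos by (metis int_one_le_iff_zero_less mult_pos_pos order_antisym_conv not_less)
    then have "a = 1" "b = 1" using pos by (auto simp: zmult_eq_1_iff)
    then show False using ab assms(3) by simp
  qed
  then interpret biquadratic a b c
    using pos c assms(1,2,4,5) sq unfolding ab by unfold_locales auto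
  have K: "K = span" using assms(6) rat_adjoin_eq_span by (simp only: ab P_def Q_def)
  have PQR: "sqrt (of_int (b * c)) \<in> K" "sqrt (of_int (a * c)) \<in> K" "sqrt (of_int (a * b)) \<in> K"
    using spanI[of 0 1 0 0] spanI[of 0 0 1 0] spanI[of 0 0 0 1] unfolding K by (simp_all add: quad_def P_def Q_def R_def)
  have ge: "n \<ge> 10 \<and> n \<noteq> 13" if "squarefree n" "n > 1" "sqrt (of_int n) \<in> K" for n :: int
  proof -
    have "n \<noteq> k" if "sqrt (of_int k) \<notin> K" for k using \<open>sqrt (of_int n) \<in> K\<close> that by blast
    then have "n \<notin> {2, 3, 5, 6, 7}" "n \<noteq> 13"
      using assms(7-12) by auto
    then show ?thesis using squarefree_ge_10[OF that(1,2)] by simp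
  qed
  have "admissible a b c"
    unfolding admissible_def using ge[OF sqfree(1) gt1(1) PQR(1)] ge[OF sqfree(2) gt1(2) PQR(2)]
      ge[OF sqfree(3) gt1(3) PQR(3)] biquadratic_axioms by blast
  then show ?thesis unfolding K by (rule biquadratic_pythagoras_ge_6)
qed

end
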